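(* Let $0<\alpha<2$, $H>0$, $H'>0$ and $N,d\ge 1$. Let $(X_s)_{s\in\mathbb{R}^d}$ be a measurable $(\alpha,H)$-FSF on a probability space $(\Omega,\mathcal{F},\mathbf{P})$, let $\{f_s\}_{s\in\mathbb{R}^d}\subset L^\alpha(E,m)$ be a jointly measurable representation of $X$, and let $(\tau_t)_{t\in\mathbb{R}^N}$ be a measurable $(N,d,H')$-field on a different probability space $(\Omega',\mathcal{F}',\mathbf{P}')$ with $\mathbf{E}'\|\tau_t\|^{H\alpha}<\infty$ for all $t\in\mathbb{R}^N$. Then the $\alpha$-stabilized random-time kernel $\{f_{\tau_t}\}_{t\in\mathbb{R}^N}$ is a representation, with control measure $\mathbf{P}'\times m$, of an $(\alpha,\tilde H)$-FSF with $\tilde H=H'H$.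
   Context: Rigid motions and stationary increments: $\mathcal{G}(\mathbb{R}^N)$ is the set of Euclidean rigid motions of $\mathbb{R}^N$. A (real- or vector-valued) random field $(Z_t)_{t\in\mathbb{R}^N}$ has stationary increments in the strong sense (sis) if for all $g\in\mathcal{G}(\mathbb{R}^N)$, $(Z_{g(t)}-Z_{g(0)})_{t\in\mathbb{R}^N}$ and $(Z_t-Z_0)_{t\in\mathbb{R}^N}$ have the same finite-dimensional distributions. It is $H$-self-similar if for all $c>0$, $(Z_{ct})_t$ and $(c^HZ_t)_t$ have the same finite-dimensional distributions. It is $H$-sssis if both hold. An $(\alpha,H)$-FSF (isotropic fractional stable field) is a (jointly) measurable real-valued field that is symmetric $\alpha$-stable (S$\alpha$S) and $H$-sssis. An $(N,d,H')$-field is an $\mathbb{R}^d$-valued random field indexed by $\mathbb{R}^N$ that is $H'$-sssis. Representation: given a measure space $(E,\mathcal{B},m)$ with $m$ $\sigma$-finite, let $M_\alpha$ be an S$\alpha$S random measure with control measure $m$. A family $\{f_s\}_{s\in S}\subset L^\alpha(E,m)$ is a representation (with control measure $m$) of an S$\alpha$S process $(X_s)_{s\in S}$ if $X$ has the same finite-dimensional distributions as $\left(\int_E f_s\,dM_\alpha\right)_{s\in S}$; equivalently, for all $\theta_j\in\mathbb{R}$, $s_j\in S$, $\mathbf{E}\exp\big(i\sum_{j}\theta_jX_{s_j}\big)=\exp\big(-\int_E|\sum_{j}\theta_jf_{s_j}(x)|^\alpha\,m(dx)\big)$. Jointly measurable means that $(s,x)\mapsto f_s(x)$ is measurable. The $\alpha$-stabilized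 random-time kernel is the family of functions $(\omega',x)\mapsto f_{\tau_t(\omega')}(x)$, $t\in\mathbb{R}^N$, on $\Omega'\times E$, regarded as elements of $L^\alpha(\Omega'\times E,\mathbf{P}'\times m)$. $\mathbf{E}'$ denotes expectation under $\mathbf{P}'$. *)

theory Defs
  imports "HOL-Probability.Probability"
begin

text \<open>
  A random field on a probability space is a curried function, index first and sample point
  second. Fields on \<open>\<real>\<^sup>N\<close> are indexed by \<^typ>\<open>real ^ 'n\<close>.
\<close>

definition random_field ::
  "'w measure \<Rightarrow> ('i \<Rightarrow> 'w \<Rightarrow> 'b::topological_space) \<Rightarrow> bool" where
  "random_field M Z \<longleftrightarrow> prob_space M \<and> (\<forall>t. Z t \<in> M \<rightarrow>\<^sub>M borel)"

definition measurable_field ::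
  "'w measure \<Rightarrow> ('i::topological_space \<Rightarrow> 'w \<Rightarrow> 'b::topological_space) \<Rightarrow> bool" where
  "measurable_field M Z \<longleftrightarrow> (\<lambda>(t, \<omega>). Z t \<omega>) \<in> borel \<Otimes>\<^sub>M M \<rightarrow>\<^sub>M borel"

text \<open>Only meaningful for fields whose components are measurable.\<close>

definition same_fdd ::
  "'w measure \<Rightarrow> ('i \<Rightarrow> 'w \<Rightarrow> 'b::topological_space) \<Rightarrow>
   'v measure \<Rightarrow> ('i \<Rightarrow> 'v \<Rightarrow> 'b) \<Rightarrow> bool" where
  "same_fdd M Z M' Z' \<longleftrightarrow>
     (\<forall>I. finite I \<longrightarrow>
        distr M (\<Pi>\<^sub>M i\<in>I. borel) (\<lambda>\<omega>. \<lambda>i\<in>I. Z i \<omega>) =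
        distr M' (\<Pi>\<^sub>M i\<in>I. borel) (\<lambda>\<omega>. \<lambda>i\<in>I. Z' i \<omega>))"

text \<open>
  Rigid motions are taken to be orientation preserving (rotations followed by translations).
  On the line they are the translations, so that stationarity of increments in the strong
  sense is then ordinary stationarity of increments.
\<close>

definition rigid_motions :: "(real ^ 'n \<Rightarrow> real ^ 'n) set" where
  "rigid_motions = {g. \<exists>A b. rotation_matrix A \<and> g = (\<lambda>t. A *v t + b)}"

definition sis :: "'w measure \<Rightarrow> (real ^ 'n \<Rightarrow> 'w \<Rightarrow> 'b::real_normed_vector) \<Rightarrow> bool" where
  "sis M Z \<longleftrightarrow>
     (\<forall>g\<in>rigid_motions.
        same_fdd M (\<lambda>t \<omega>. Z (g t) \<omega> - Z (g 0) \<omega>) M (\<lambda>t \<omega>. Z t \<omega> - Z 0 \<omega>))"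

definition self_similar ::
  "real \<Rightarrow> 'w measure \<Rightarrow> (real ^ 'n \<Rightarrow> 'w \<Rightarrow> 'b::real_normed_vector) \<Rightarrow> bool" where
  "self_similar H M Z \<longleftrightarrow>
     (\<forall>c>0. same_fdd M (\<lambda>t. Z (c *\<^sub>R t)) M (\<lambda>t \<omega>. (c powr H) *\<^sub>R Z t \<omega>))"

definition sssis ::
  "real \<Rightarrow> 'w measure \<Rightarrow> (real ^ 'n \<Rightarrow> 'w \<Rightarrow> 'b::real_normed_vector) \<Rightarrow> bool" where
  "sssis H M Z \<longleftrightarrow> self_similar H M Z \<and> sis M Z"

text \<open>
  The scale parameter \<open>\<sigma>\<close> may vanish, i.e. the constant 0 counts as symmetric \<open>\<alpha>\<close>-stable.
  This is needed already because a self-similar field with \<open>H > 0\<close> vanishes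
  almost surely at the origin.
\<close>

definition sas_variable :: "real \<Rightarrow> 'w measure \<Rightarrow> ('w \<Rightarrow> real) \<Rightarrow> bool" where
  "sas_variable \<alpha> M Y \<longleftrightarrow> Y \<in> borel_measurable M \<and>
     (\<exists>\<sigma>\<ge>0. \<forall>u. char (distr M borel Y) u =
        complex_of_real (exp (- (\<sigma> powr \<alpha> * \<bar>u\<bar> powr \<alpha>))))"

definition sas_process :: "real \<Rightarrow> 'w measure \<Rightarrow> ('i \<Rightarrow> 'w \<Rightarrow> real) \<Rightarrow> bool" where
  "sas_process \<alpha> M X \<longleftrightarrow>
     (\<forall>(n::nat) \<theta> s. sas_variable \<alpha> M (\<lambda>\<omega>. \<Sum>j<n. \<theta> j * X (s j) \<omega>))"

definition FSF :: "real \<Rightarrow> real \<Rightarrow> 'w measure \<Rightarrow> (real ^ 'n \<Rightarrow> 'w \<Rightarrow> real) \<Rightarrow> bool" where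
  "FSF \<alpha> H M X \<longleftrightarrow>
     random_field M X \<and> measurable_field M X \<and> sas_process \<alpha> M X \<and> sssis H M X"

text \<open>\<open>(N,d,H)\<close>-fields; the dimensions \<open>N\<close> and \<open>d\<close> are carried by the types.\<close>

definition NdH_field ::
  "real \<Rightarrow> 'w measure \<Rightarrow> (real ^ 'n \<Rightarrow> 'w \<Rightarrow> real ^ 'd) \<Rightarrow> bool" where
  "NdH_field H M Z \<longleftrightarrow> random_field M Z \<and> sssis H M Z"

definition in_Lalpha :: "real \<Rightarrow> 'e measure \<Rightarrow> ('e \<Rightarrow> real) \<Rightarrow> bool" where
  "in_Lalpha \<alpha> m h \<longleftrightarrow>
     h \<in> borel_measurable m \<and> integrable m (\<lambda>x. \<bar>h x\<bar> powr \<alpha>)"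

text \<open>
  The characteristic-function identity says that \<open>X\<close> has the finite-dimensional distributions of
  the stochastic integrals of the \<open>f s\<close> against a symmetric \<open>\<alpha>\<close>-stable random measure with
  control measure \<open>m\<close>.
\<close>

definition stable_representation ::
  "real \<Rightarrow> 'e measure \<Rightarrow> ('i \<Rightarrow> 'e \<Rightarrow> real) \<Rightarrow> 'w measure \<Rightarrow> ('i \<Rightarrow> 'w \<Rightarrow> real) \<Rightarrow> bool" where
  "stable_representation \<alpha> m f M X \<longleftrightarrow>
     sigma_finite_measure m \<and> (\<forall>s. in_Lalpha \<alpha> m (f s)) \<and>
     (\<forall>(n::nat) \<theta> s.
        (CLINT \<omega>|M. iexp (\<Sum>j<n. \<theta> j * X (s j) \<omega>)) =
        complex_of_real (exp (- (LINT x|m. \<bar>\<Sum>j<n. \<theta> j * f (s j) x\<bar> powr \<alpha>))))"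

definition jointly_measurable_kernel ::
  "'e measure \<Rightarrow> ('i::topological_space \<Rightarrow> 'e \<Rightarrow> real) \<Rightarrow> bool" where
  "jointly_measurable_kernel m f \<longleftrightarrow> (\<lambda>(s, x). f s x) \<in> borel_measurable (borel \<Otimes>\<^sub>M m)"

definition random_time_kernel ::
  "('i \<Rightarrow> 'e \<Rightarrow> real) \<Rightarrow> ('t \<Rightarrow> 'v \<Rightarrow> 'i) \<Rightarrow> 't \<Rightarrow> 'v \<times> 'e \<Rightarrow> real" where
  "random_time_kernel f \<tau> t = (\<lambda>(\<omega>', x). f (\<tau> t \<omega>') x)"

text \<open>
  The kernel \<open>f\<close> represents some \<open>(\<alpha>,H)\<close>-FSF. HOL cannot quantify existentially over the type
  of the sample space, so it is fixed to \<^typ>\<open>nat \<Rightarrow> real \<times> 'e\<close>: sequences of marked points,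
  the sample space of the LePage series of the stable integral.
\<close>

definition represents_FSF ::
  "real \<Rightarrow> real \<Rightarrow> 'e measure \<Rightarrow> (real ^ 'n \<Rightarrow> 'e \<Rightarrow> real) \<Rightarrow> bool" where
  "represents_FSF \<alpha> H m f \<longleftrightarrow>
     (\<exists>(Q :: (nat \<Rightarrow> real \<times> 'e) measure) Y.
        FSF \<alpha> H Q Y \<and> stable_representation \<alpha> m f Q Y)"

end

theory Submission
  imports Defs
begin

text \<open>
  Write \<open>\<Phi>(\<theta>, s) = \<integral> \<bar>\<Sum>\<^sub>j \<theta>\<^sub>j f\<^bsub>s\<^sub>j\<^esub>\<bar>\<^sup>\<alpha> dm\<close>, minus the logarithm of the characteristic function of the
  finite-dimensional distributions of \<open>X\<close>. Self-similarity of \<open>X\<close> says that \<open>\<Phi>\<close> is homogeneous of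
  degree \<open>H\<alpha>\<close> in \<open>s\<close>, and stationarity of the increments that it is invariant under translations of
  \<open>s\<close> when \<open>\<Sum>\<^sub>j \<theta>\<^sub>j = 0\<close>; together they give \<open>\<integral> \<bar>f\<^sub>s\<bar>\<^sup>\<alpha> dm \<le> C \<parallel>s\<parallel>\<^bsup>H\<alpha>\<^esup>\<close>. By Fubini the exponent of the
  random-time kernel is \<open>E' \<Phi>(\<theta>, \<tau>\<^sub>t)\<close>, so the moment assumption puts the kernel in \<open>L\<^sup>\<alpha>\<close>, and the
  invariances of \<open>\<Phi>\<close> combine with those of the law of \<open>\<tau>\<close> to give the scaling with exponent \<open>H'H\<close> and
  the stationary increments. By the Cramer-Wold device these properties of the exponent are
  properties of the finite-dimensional distributions.

  A jointly measurable process with a given exponent is obtained from a LePage series with Gaussian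
  multipliers: given the points \<open>(\<Gamma>\<^sub>i, V\<^sub>i)\<close> of a Poisson process, \<open>\<Sum>\<^sub>i g\<^sub>i \<Gamma>\<^sub>i\<^bsup>-1/\<alpha>\<^esup> h\<^sub>t(V\<^sub>i)\<close> is Gaussian with
  variance \<open>\<Sum>\<^sub>i \<Gamma>\<^sub>i\<^bsup>-2/\<alpha>\<^esup> h\<^sub>t(V\<^sub>i)\<^sup>2\<close>, a positive \<open>\<alpha>/2\<close>-stable sum (finite since \<open>\<alpha> < 2\<close>) whose Laplace
  transform is explicit.
\<close>

section \<open>Gaussian series\<close>

text \<open>The integrand depends on the coordinates in \<open>J\<close> only, so the infinite
  product is pushed forward to the finite product over \<open>J\<close>, where Fubini applies. Real
  integrands occur for moments and Laplace transforms, complex ones for characteristic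
  functions.\<close>

lemma integral_PiM_prod:
  fixes f :: "'i \<Rightarrow> 'a \<Rightarrow> 'b::{real_normed_field,banach,second_countable_topology}"
  assumes M: "\<And>i. prob_space (M i)" and J: "finite J"
    and f: "\<And>i. i \<in> J \<Longrightarrow> integrable (M i) (f i)"
  shows "(\<integral>x. (\<Prod>i\<in>J. f i (x i)) \<partial>PiM UNIV M) = (\<Prod>i\<in>J. integral\<^sup>L (M i) (f i))"
    and "integrable (PiM UNIV M) (\<lambda>x. \<Prod>i\<in>J. f i (x i))"
proof -
  interpret product_prob_space M UNIV
    using M by (simp add: product_prob_space_def product_prob_space_axioms_def product_sigma_finite_def
        prob_space_imp_sigma_finite)
  have [measurable]: "f i \<in> borel_measurable (M i)" if "i \<in> J" for i
    using f[OF that] by simp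
  have d: "distr (PiM UNIV M) (PiM J M) (\<lambda>x. restrict x J) = PiM J M"
    using J by (intro distr_PiM_restrict_finite) auto
  have r: "(\<lambda>x. restrict x J) \<in> PiM UNIV M \<rightarrow>\<^sub>M PiM J M"
    by (rule measurable_restrict_subset) simp
  have b: "(\<lambda>x. \<Prod>i\<in>J. f i (x i)) \<in> borel_measurable (PiM J M)"
    by measurable
  have e: "(\<Prod>i\<in>J. f i (restrict x J i)) = (\<Prod>i\<in>J. f i (x i))" for x
    by (intro prod.cong) auto
  have "(\<integral>x. (\<Prod>i\<in>J. f i (x i)) \<partial>PiM UNIV M)
      = (\<integral>x. (\<Prod>i\<in>J. f i (x i)) \<partial>distr (PiM UNIV M) (PiM J M) (\<lambda>x. restrict x J))"
    by (subst integral_distr[OF r b]) (simp only: e)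
  then show "(\<integral>x. (\<Prod>i\<in>J. f i (x i)) \<partial>PiM UNIV M) = (\<Prod>i\<in>J. integral\<^sup>L (M i) (f i))"
    unfolding d using product_integral_prod[OF J, of f] f by simp
  have "integrable (distr (PiM UNIV M) (PiM J M) (\<lambda>x. restrict x J)) (\<lambda>x. \<Prod>i\<in>J. f i (x i))"
    unfolding d using product_integrable_prod[OF J, of f] f by simp
  then show "integrable (PiM UNIV M) (\<lambda>x. \<Prod>i\<in>J. f i (x i))"
    by (subst (asm) integrable_distr_eq[OF r b]) (simp only: e)
qed

definition gauss_seq :: "(nat \<Rightarrow> real) measure" where
  "gauss_seq = PiM UNIV (\<lambda>_. std_normal_distribution)"

lemma prob_space_std_normal: "prob_space std_normal_distribution"
  using real_dist_normal_dist by (simp add: real_distribution_def)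

lemma prob_space_gauss_seq: "prob_space gauss_seq"
  unfolding gauss_seq_def by (intro prob_space_PiM prob_space_std_normal)

lemma sets_gauss_seq [measurable_cong]: "sets gauss_seq = sets (PiM UNIV (\<lambda>_. borel))"
  unfolding gauss_seq_def by (intro sets_PiM_cong) simp_all

lemma gauss_seq_orthonormal:
  shows "(\<integral>g. g i * g j \<partial>gauss_seq) = (if i = j then 1 else 0)"
    and "integrable gauss_seq (\<lambda>g. g i * g j)"
proof -
  note I = integral_PiM_prod[where M="\<lambda>_. std_normal_distribution",
      OF prob_space_std_normal, folded gauss_seq_def]
  have 1: "integrable std_normal_distribution (\<lambda>x. x)" "(LINT x|std_normal_distribution. x) = 0"
    using integrable_std_normal_distribution_moment[of 1]
      integral_std_normal_distribution_moment_odd[of 1] by simp_all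
  have 2: "integrable std_normal_distribution (\<lambda>x. x * x)" "(LINT x|std_normal_distribution. x * x) = 1"
    using integrable_std_normal_distribution_moment[of 2]
      std_normal_distribution_even_moments(1)[of 1] by (simp_all add: power2_eq_square)
  \<comment> \<open>The square of one coordinate is a one-factor product; for
    \<open>i \<noteq> j\<close> the integral splits into two vanishing means.\<close>
  show "(\<integral>g. g i * g j \<partial>gauss_seq) = (if i = j then 1 else 0)"
    using I(1)[of "{i}" "\<lambda>_ x. x * x"] I(1)[of "{i, j}" "\<lambda>_ x. x"] 1 2
    by (cases "i = j") (simp_all add: gauss_seq_def)
  show "integrable gauss_seq (\<lambda>g. g i * g j)"
    using I(2)[of "{i}" "\<lambda>_ x. x * x"] I(2)[of "{i, j}" "\<lambda>_ x. x"] 1 2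
    by (cases "i = j") (simp_all add: gauss_seq_def)
qed

lemma gauss_seq_second_moment:
  assumes "finite F"
  shows "(\<integral>g. (\<Sum>i\<in>F. a i * g i)\<^sup>2 \<partial>gauss_seq) = (\<Sum>i\<in>F. (a i)\<^sup>2)"
    and "integrable gauss_seq (\<lambda>g. (\<Sum>i\<in>F. a i * g i)\<^sup>2)"
proof -
  have e: "(\<Sum>i\<in>F. a i * g i)\<^sup>2 = (\<Sum>i\<in>F. \<Sum>j\<in>F. (a i * a j) * (g i * g j))" for g
    unfolding power2_eq_square sum_product by (simp add: mult_ac)
  note [simp] = gauss_seq_orthonormal
  show "integrable gauss_seq (\<lambda>g. (\<Sum>i\<in>F. a i * g i)\<^sup>2)"
    unfolding e by (intro Bochner_Integration.integrable_sum integrable_mult_right) simp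
  have "(\<integral>g. (\<Sum>i\<in>F. a i * g i)\<^sup>2 \<partial>gauss_seq)
      = (\<Sum>i\<in>F. \<Sum>j\<in>F. (a i * a j) * (if i = j then 1 else 0))"
    unfolding e by (subst Bochner_Integration.integral_sum) (auto intro!: sum.cong)
  also have "\<dots> = (\<Sum>i\<in>F. (a i)\<^sup>2)"
    using assms by (intro sum.cong) (auto simp: power2_eq_square if_distrib sum.delta' cong: if_cong)
  finally show "(\<integral>g. (\<Sum>i\<in>F. a i * g i)\<^sup>2 \<partial>gauss_seq) = (\<Sum>i\<in>F. (a i)\<^sup>2)" .
qed

lemma gauss_seq_finite_char:
  assumes "finite F"
  shows "(CLINT g|gauss_seq. iexp (\<Sum>i\<in>F. a i * g i)) = complex_of_real (exp (- (\<Sum>i\<in>F. (a i)\<^sup>2) / 2))"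
proof -
  have i: "integrable std_normal_distribution (\<lambda>x. iexp (a i * x))" for i
    by (rule prob_space.integrable_iexp[OF prob_space_std_normal]) simp_all
  have c: "(CLINT x|std_normal_distribution. iexp (a i * x)) = complex_of_real (exp (- (a i)\<^sup>2 / 2))" for i
    using fun_cong[OF char_std_normal_distribution, of "a i"] by (simp add: char_def)
  have "(CLINT g|gauss_seq. iexp (\<Sum>i\<in>F. a i * g i)) = (CLINT g|gauss_seq. (\<Prod>i\<in>F. iexp (a i * g i)))"
    using assms by (simp add: sum_distrib_left exp_sum)
  also have "\<dots> = (\<Prod>i\<in>F. complex_of_real (exp (- (a i)\<^sup>2 / 2)))"
    unfolding gauss_seq_def c[symmetric]
    by (rule integral_PiM_prod[OF prob_space_std_normal assms i])
  also have "\<dots> = complex_of_real (exp (- (\<Sum>i\<in>F. (a i)\<^sup>2) / 2))"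
    using assms by (simp add: exp_sum[symmetric] sum_negf sum_divide_distrib flip: of_real_prod)
  finally show ?thesis .
qed

text \<open>The partial sums are evaluated along indices chosen as a measurable function of the coefficients,
  which makes the convergence fast enough to hold almost surely without a maximal inequality.\<close>

definition cut :: "(nat \<Rightarrow> real) \<Rightarrow> nat \<Rightarrow> nat" where
  "cut a k = (LEAST n. k \<le> n \<and> (\<forall>m\<ge>n. (\<Sum>i\<in>{n..<m}. (a i)\<^sup>2) \<le> (1/4) ^ k))"

text \<open>\<open>lim\<close> is total: the value is arbitrary where the partial sums diverge, an
  event of probability zero when \<open>a\<close> is square summable.\<close>

definition gsum :: "(nat \<Rightarrow> real) \<Rightarrow> (nat \<Rightarrow> real) \<Rightarrow> real" where
  "gsum a g = lim (\<lambda>k. \<Sum>i<cut a k. a i * g i)"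

text \<open>Coefficients and Gaussians both vary with \<open>x\<close> here; this later makes the
  field jointly measurable. The varying number of terms is handled by splitting over the countably
  many values of \<open>cut\<close>.\<close>

lemma measurable_gsum:
  assumes [measurable]: "\<And>i. (\<lambda>x. a x i) \<in> borel_measurable M" "\<And>i. (\<lambda>x. g x i) \<in> borel_measurable M"
  shows "(\<lambda>x. gsum (a x) (g x)) \<in> borel_measurable M"
proof -
  have [measurable]: "(\<lambda>x. cut (a x) k) \<in> M \<rightarrow>\<^sub>M count_space UNIV" for k
    unfolding cut_def by measurable
  have "(\<lambda>x. \<Sum>i<cut (a x) k. a x i * g x i) \<in> borel_measurable M" for k
    by (rule measurable_compose_countable[where f="\<lambda>n x. \<Sum>i<n. a x i * g x i"]) measurable
  then show ?thesis
    unfolding gsum_def by (rule borel_measurable_lim_metric)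
qed

text \<open>Square summability provides admissible indices by the Cauchy criterion. An index
  admissible at level \<open>Suc k\<close> is admissible at level \<open>k\<close>, and
  \<open>cut\<close> takes the least one, hence the monotonicity.\<close>

lemma cut_props:
  assumes "summable (\<lambda>i. (a i)\<^sup>2)"
  shows "k \<le> cut a k" "\<And>m. cut a k \<le> m \<Longrightarrow> (\<Sum>i\<in>{cut a k..<m}. (a i)\<^sup>2) \<le> (1/4) ^ k"
    "cut a k \<le> cut a (Suc k)"
proof -
  let ?P = "\<lambda>k n. k \<le> n \<and> (\<forall>m\<ge>n. (\<Sum>i\<in>{n..<m}. (a i)\<^sup>2) \<le> (1/4::real) ^ k)"
  have ex: "\<exists>n. ?P k n" for k
  proof -
    have "0 < (1/4::real) ^ k" by simp
    then obtain N where N: "\<And>m n. N \<le> m \<Longrightarrow> norm (\<Sum>i\<in>{m..<n}. (a i)\<^sup>2) < (1/4) ^ k"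
      using assms unfolding summable_Cauchy by blast
    have "?P k (max k N)"
      using N[of "max k N"] by (auto simp: sum_nonneg intro: less_imp_le)
    then show ?thesis by blast
  qed
  have P: "?P k (cut a k)" for k
    unfolding cut_def by (rule LeastI_ex[OF ex])
  then show "k \<le> cut a k" "\<And>m. cut a k \<le> m \<Longrightarrow> (\<Sum>i\<in>{cut a k..<m}. (a i)\<^sup>2) \<le> (1/4) ^ k"
    by auto
  have "(1/4::real) ^ Suc k \<le> (1/4) ^ k" by simp
  then have "?P k (cut a (Suc k))"
    using P[of "Suc k"] by (meson Suc_leD order_trans)
  then show "cut a k \<le> cut a (Suc k)"
    unfolding cut_def[of a k] by (rule Least_le)
qed

text \<open>By orthonormality the increment of the partial sums from \<open>cut a k\<close> to
  \<open>cut a (Suc k)\<close> has second moment at most \<open>(1/4) ^ k\<close>. These bounds are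
  summable even after multiplication by \<open>2 ^ k\<close>, so the weighted squares are almost
  surely summable, and with them the increments.\<close>

lemma AE_gsum_tendsto:
  assumes a: "summable (\<lambda>i. (a i)\<^sup>2)"
  shows "AE g in gauss_seq. (\<lambda>k. \<Sum>i<cut a k. a i * g i) \<longlonglongrightarrow> gsum a g"
proof -
  define S where "S k g = (\<Sum>i<cut a k. a i * g i)" for k g
  have S: "S (Suc k) g - S k g = (\<Sum>i\<in>{cut a k..<cut a (Suc k)}. a i * g i)" for k g
    unfolding S_def using sum_diff_nat_ivl[of 0 "cut a k" "cut a (Suc k)"] cut_props(3)[OF a, of k]
    by (simp add: atLeast0LessThan)
  have [measurable]: "S k \<in> borel_measurable gauss_seq" for k
    unfolding S_def by measurable
  have m: "(\<integral>\<^sup>+g. ennreal (2 ^ k * (S (Suc k) g - S k g)\<^sup>2) \<partial>gauss_seq) \<le> ennreal ((1/2) ^ k)" for k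
  proof -
    have "(\<integral>\<^sup>+g. ennreal (2 ^ k * (S (Suc k) g - S k g)\<^sup>2) \<partial>gauss_seq)
        = ennreal (2 ^ k * (\<Sum>i\<in>{cut a k..<cut a (Suc k)}. (a i)\<^sup>2))"
      unfolding S by (subst nn_integral_eq_integral) (auto simp: gauss_seq_second_moment)
    also have "\<dots> \<le> ennreal (2 ^ k * (1/4) ^ k)"
      by (intro ennreal_leI mult_left_mono cut_props(2)[OF a] cut_props(3)[OF a]) simp
    also have "2 ^ k * (1/4) ^ k = (1/2::real) ^ k"
      by (simp flip: power_mult_distrib)
    finally show ?thesis .
  qed
  have "(\<integral>\<^sup>+g. (\<Sum>k. ennreal (2 ^ k * (S (Suc k) g - S k g)\<^sup>2)) \<partial>gauss_seq) \<le> (\<Sum>k. ennreal ((1/2) ^ k))"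
    by (subst nn_integral_suminf) (auto intro!: suminf_le m)
  also have "\<dots> < \<infinity>"
    by (subst suminf_ennreal2) (auto simp: summable_geometric)
  finally have "AE g in gauss_seq. (\<Sum>k. ennreal (2 ^ k * (S (Suc k) g - S k g)\<^sup>2)) \<noteq> \<infinity>"
    by (intro nn_integral_PInf_AE) auto
  then show ?thesis
  proof eventually_elim
    case (elim g)
    then have 1: "summable (\<lambda>k. 2 ^ k * (S (Suc k) g - S k g)\<^sup>2)"
      by (intro summable_suminf_not_top) auto
    \<comment> \<open>\<open>\<bar>x\<bar> \<le> \<epsilon> + x\<^sup>2 / \<epsilon>\<close> with \<open>\<epsilon> = 2\<^sup>-\<^sup>k\<close>\<close>
    have "norm (S (Suc k) g - S k g) \<le> (1/2) ^ k + 2 ^ k * (S (Suc k) g - S k g)\<^sup>2" for k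
    proof -
      define x where "x = \<bar>S (Suc k) g - S k g\<bar>"
      define e where "e = (1/2::real) ^ k"
      have e: "e > 0" "2 ^ k = 1 / e" by (auto simp: e_def power_divide)
      have "x \<le> e + x\<^sup>2 / e"
      proof (cases "x \<le> e")
        case False
        then have "x * e \<le> x * x" using e x_def by (intro mult_left_mono) auto
        then have "x \<le> x\<^sup>2 / e" using e by (simp add: field_simps power2_eq_square)
        then show ?thesis using e by linarith
      qed (use e in \<open>simp add: add_increasing2\<close>)
      then show ?thesis unfolding e e_def[symmetric] x_def by simp
    qed
    then have "summable (\<lambda>k. S (Suc k) g - S k g)"
      by (intro summable_comparison_test'[where N=0, OF summable_add[OF summable_geometric 1]]) auto
    then have "convergent (\<lambda>n. \<Sum>k<n. S (Suc k) g - S k g)"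
      by (simp add: summable_iff_convergent)
    then have "convergent (\<lambda>n. (\<Sum>k<n. S (Suc k) g - S k g) + S 0 g)"
      by (intro convergent_add convergent_const)
    then have "convergent (\<lambda>k. S k g)"
      by (simp add: sum_lessThan_telescope[where f="\<lambda>k. S k g"])
    then show ?case
      unfolding gsum_def S_def convergent_LIMSEQ_iff .
  qed
qed

lemma sum_power2_le:
  fixes x :: "nat \<Rightarrow> real"
  shows "(\<Sum>j<n. x j)\<^sup>2 \<le> n * (\<Sum>j<n. (x j)\<^sup>2)"
  using Cauchy_Schwarz_ineq_sum[of "\<lambda>_. 1" x "{..<n}"] by simp

text \<open>The sums stopped at \<open>cut\<close> are finite Gaussian sums with explicit
  characteristic functions. Dominated convergence gives the limit on the left, Tannery's theorem for
  the variances the limit on the right.\<close>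

lemma gsum_char:
  fixes a :: "nat \<Rightarrow> nat \<Rightarrow> real"
  assumes a: "\<And>j. j < n \<Longrightarrow> summable (\<lambda>i. (a j i)\<^sup>2)"
  shows "summable (\<lambda>i. (\<Sum>j<n. \<theta> j * a j i)\<^sup>2)" (is ?A)
    and "(CLINT g|gauss_seq. iexp (\<Sum>j<n. \<theta> j * gsum (a j) g))
      = complex_of_real (exp (- (\<Sum>i. (\<Sum>j<n. \<theta> j * a j i)\<^sup>2) / 2))" (is ?B)
proof -
  interpret prob_space gauss_seq by (rule prob_space_gauss_seq)
  \<comment> \<open>A summable majorant, by Cauchy-Schwarz over the \<open>n\<close> summands, of
    the squared combined coefficients, whether truncated or not.\<close>
  define b where "b i = n * (\<Sum>j<n. (\<theta> j)\<^sup>2 * (a j i)\<^sup>2)" for i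
  have b: "summable b"
    unfolding b_def by (intro summable_mult summable_sum) (use a in auto)
  \<comment> \<open>The cut depends on \<open>j\<close>; padding with zeros puts all truncated sums
    on one index range, of length \<open>K k\<close> below.\<close>
  define c where "c k i = (\<Sum>j<n. \<theta> j * (if i < cut (a j) k then a j i else 0))" for k i
  have cb: "(c k i)\<^sup>2 \<le> b i" for k i
  proof -
    have "(c k i)\<^sup>2 \<le> n * (\<Sum>j<n. (\<theta> j * (if i < cut (a j) k then a j i else 0))\<^sup>2)"
      unfolding c_def by (rule sum_power2_le)
    also have "\<dots> \<le> b i"
      unfolding b_def by (intro mult_left_mono sum_mono) (auto simp: power_mult_distrib)
    finally show ?thesis .
  qed
  have "(\<Sum>j<n. \<theta> j * a j i)\<^sup>2 \<le> b i" for i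
    unfolding b_def using sum_power2_le[of "\<lambda>j. \<theta> j * a j i" n] by (simp add: power_mult_distrib)
  then show ?A
    by (intro summable_comparison_test'[OF b, where N=0]) simp
  define K where "K k = Max (insert 0 ((\<lambda>j. cut (a j) k) ` {..<n}))" for k
  have K: "cut (a j) k \<le> K k" if "j < n" for j k
    unfolding K_def using that by (intro Max_ge) auto
  have cK: "c k i = 0" if "i \<ge> K k" for k i
  proof -
    have "\<not> i < cut (a j) k" if "j < n" for j
      using K[OF that, of k] \<open>i \<ge> K k\<close> by simp
    then show ?thesis unfolding c_def by simp
  qed
  have sumc: "(\<Sum>j<n. \<theta> j * (\<Sum>i<cut (a j) k. a j i * g i)) = (\<Sum>i<K k. c k i * g i)" for k g
  proof -
    have "(\<Sum>i<cut (a j) k. a j i * g i) = (\<Sum>i<K k. (if i < cut (a j) k then a j i else 0) * g i)"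
      if "j < n" for j
      using K[OF that, of k]
      by (intro sum.mono_neutral_cong_left) auto
    then have "(\<Sum>j<n. \<theta> j * (\<Sum>i<cut (a j) k. a j i * g i))
        = (\<Sum>j<n. \<Sum>i<K k. \<theta> j * (if i < cut (a j) k then a j i else 0) * g i)"
      by (intro sum.cong) (auto simp: sum_distrib_left mult_ac)
    also have "\<dots> = (\<Sum>i<K k. c k i * g i)"
      by (subst sum.swap) (simp add: c_def sum_distrib_right)
    finally show ?thesis .
  qed
  have gm: "gsum (a j) \<in> borel_measurable gauss_seq" for j
    by (rule measurable_gsum) measurable
  define Y where "Y = (\<lambda>g. \<Sum>j<n. \<theta> j * gsum (a j) g)"
  have [measurable]: "Y \<in> borel_measurable gauss_seq"
    unfolding Y_def by (intro borel_measurable_sum borel_measurable_times gm) simp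
  have "AE g in gauss_seq. \<forall>j\<in>{..<n}. (\<lambda>k. \<Sum>i<cut (a j) k. a j i * g i) \<longlonglongrightarrow> gsum (a j) g"
    by (rule AE_finite_allI) (auto intro: AE_gsum_tendsto a)
  then have "AE g in gauss_seq. (\<lambda>k. iexp (\<Sum>j<n. \<theta> j * (\<Sum>i<cut (a j) k. a j i * g i)))
      \<longlonglongrightarrow> iexp (Y g)"
    unfolding Y_def by eventually_elim (intro isCont_tendsto_compose[OF isCont_iexp] tendsto_intros, auto)
  then have "(\<lambda>k. CLINT g|gauss_seq. iexp (\<Sum>j<n. \<theta> j * (\<Sum>i<cut (a j) k. a j i * g i)))
      \<longlonglongrightarrow> (CLINT g|gauss_seq. iexp (Y g))"
    by (intro integral_dominated_convergence[where w="\<lambda>_. 1"])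
      (auto simp del: of_real_sum of_real_mult)
  moreover have "(CLINT g|gauss_seq. iexp (\<Sum>j<n. \<theta> j * (\<Sum>i<cut (a j) k. a j i * g i)))
     = complex_of_real (exp (- (\<Sum>i. (c k i)\<^sup>2) / 2))" for k
    unfolding sumc by (subst gauss_seq_finite_char, simp, subst suminf_finite[of "{..<K k}"]) (auto simp: cK)
  moreover have "(\<lambda>k. \<Sum>i. (c k i)\<^sup>2) \<longlonglongrightarrow> (\<Sum>i. (\<Sum>j<n. \<theta> j * a j i)\<^sup>2)"
  proof -
    have "(\<lambda>k. (c k i)\<^sup>2) \<longlonglongrightarrow> (\<Sum>j<n. \<theta> j * a j i)\<^sup>2" for i
    proof -
      \<comment> \<open>Since \<open>k \<le> cut (a j) k\<close>, no truncation affects the index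
        \<open>i\<close> once \<open>k > i\<close>.\<close>
      have "eventually (\<lambda>k. (\<Sum>j<n. \<theta> j * a j i)\<^sup>2 = (c k i)\<^sup>2) sequentially"
        using eventually_gt_at_top[of i]
      proof eventually_elim
        case (elim k)
        then have "i < cut (a j) k" if "j < n" for j
          using cut_props(1)[OF a[OF that], of k] by simp
        then show ?case unfolding c_def by simp
      qed
      then show ?thesis
        by (rule tendsto_eventually[OF eventually_mono]) simp
    qed
    moreover have "eventually (\<lambda>(i,k). norm ((c k i)\<^sup>2) \<le> b i) (at_top \<times>\<^sub>F sequentially)"
      using cb by (intro always_eventually) auto
    ultimately show ?thesis
      using tannerys_theorem[where a="\<lambda>i k. (c k i)\<^sup>2" and b="\<lambda>i. (\<Sum>j<n. \<theta> j * a j i)\<^sup>2" and M=b] b by simp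
  qed
  then have "(\<lambda>k. complex_of_real (exp (- (\<Sum>i. (c k i)\<^sup>2) / 2))) \<longlonglongrightarrow>
     complex_of_real (exp (- (\<Sum>i. (\<Sum>j<n. \<theta> j * a j i)\<^sup>2) / 2))"
    by (intro tendsto_intros) simp_all
  ultimately show ?B
    unfolding Y_def by (simp add: LIMSEQ_unique)
qed

section \<open>Poisson configurations and stable weights\<close>

text \<open>A Poisson(1) number together with a sequence of independent marks; only the marks with index
  below the number are points.\<close>

definition cpoisson :: "'a measure \<Rightarrow> (nat \<times> (nat \<Rightarrow> 'a)) measure" where
  "cpoisson \<nu> = measure_pmf (poisson_pmf 1) \<Otimes>\<^sub>M PiM UNIV (\<lambda>_. \<nu>)"

definition poisson_config :: "'a measure \<Rightarrow> (nat \<Rightarrow> nat \<times> (nat \<Rightarrow> 'a)) measure" where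
  "poisson_config \<nu> = PiM UNIV (\<lambda>_. cpoisson \<nu>)"

text \<open>The extension by 0 at infinity lets Laplace transforms of sums over a configuration be
  computed before these sums are known to be finite.\<close>

definition exp_neg :: "ennreal \<Rightarrow> real" where
  "exp_neg x = (if x = \<infinity> then 0 else exp (- enn2real x))"

lemma measurable_exp_neg [measurable]: "exp_neg \<in> borel_measurable borel"
  unfolding exp_neg_def[abs_def] by measurable

lemma exp_neg_le_1: "0 \<le> exp_neg x" "exp_neg x \<le> 1"
  by (auto simp: exp_neg_def)

lemma prob_space_cpoisson: "prob_space \<nu> \<Longrightarrow> prob_space (cpoisson \<nu>)"
  unfolding cpoisson_def by (intro prob_space_pair prob_space_PiM) (auto simp: measure_pmf.prob_space_axioms)

lemma prob_space_poisson_config: "prob_space \<nu> \<Longrightarrow> prob_space (poisson_config \<nu>)"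
  unfolding poisson_config_def by (intro prob_space_PiM prob_space_cpoisson)

lemma sets_cpoisson [measurable_cong]:
  "sets (cpoisson \<nu>) = sets (count_space UNIV \<Otimes>\<^sub>M PiM UNIV (\<lambda>_. \<nu>))"
  unfolding cpoisson_def by (intro sets_pair_measure_cong) simp_all

lemma sets_poisson_config [measurable_cong]:
  "sets (poisson_config \<nu>) = sets (PiM UNIV (\<lambda>_. count_space UNIV \<Otimes>\<^sub>M PiM UNIV (\<lambda>_. \<nu>)))"
  unfolding poisson_config_def by (intro sets_PiM_cong sets_cpoisson) simp_all

section \<open>Laplace functional of a Poisson configuration\<close>

lemma poisson_pgf: "(\<integral>N. z ^ N \<partial>measure_pmf (poisson_pmf 1)) = exp (z - 1 :: real)"
proof -
  have s: "(\<lambda>n. pmf (poisson_pmf 1) n *\<^sub>R z ^ n) sums (exp z * exp (-1))"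
    using sums_mult2[OF exp_converges[of z], of "exp (-1)"]
    by (simp add: field_simps)
  have s': "summable (\<lambda>n. norm (pmf (poisson_pmf 1) n *\<^sub>R z ^ n))"
    using summable_mult2[OF summable_norm_exp[of z], of "exp (-1)"]
    by (simp add: field_simps abs_mult power_abs norm_mult)
  have "(\<integral>N. z ^ N \<partial>measure_pmf (poisson_pmf 1)) =
      (\<integral>n. pmf (poisson_pmf 1) n *\<^sub>R z ^ n \<partial>count_space UNIV)"
    unfolding measure_pmf_eq_density by (subst integral_density) auto
  also have "\<dots> = (\<Sum>n. pmf (poisson_pmf 1) n *\<^sub>R z ^ n)"
    using s' by (intro integral_count_space_nat) (simp add: integrable_count_space_nat_iff)
  also have "\<dots> = exp z * exp (-1)"
    using s by (rule sums_unique[symmetric])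
  finally show ?thesis by (simp flip: exp_add)
qed

text \<open>Given the number \<open>N\<close> of points, independence of the marks makes the mean of
  the product the \<open>N\<close>-th power of the mean of \<open>z\<close>; averaging over
  \<open>N\<close> evaluates the Poisson generating function there.\<close>

lemma cpoisson_pgf:
  assumes \<nu>: "prob_space \<nu>" and [measurable]: "z \<in> borel_measurable \<nu>"
    and z: "\<And>p. 0 \<le> z p" "\<And>p. z p \<le> (1::real)"
  shows "(\<integral>x. (\<Prod>j<fst x. z (snd x j)) \<partial>cpoisson \<nu>) = exp ((\<integral>p. z p \<partial>\<nu>) - 1)"
    and "integrable (cpoisson \<nu>) (\<lambda>x. \<Prod>j<fst x. z (snd x j))"
proof -
  interpret \<nu>: prob_space \<nu> by fact
  interpret S: prob_space "PiM UNIV (\<lambda>_::nat. \<nu>)" by (intro prob_space_PiM \<nu>)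
  interpret c: prob_space "cpoisson \<nu>" by (rule prob_space_cpoisson[OF \<nu>])
  interpret pp: pair_sigma_finite "measure_pmf (poisson_pmf 1)" "PiM UNIV (\<lambda>_::nat. \<nu>)" ..
  have [measurable]: "(\<lambda>x. \<Prod>j<fst x. z (snd x j)) \<in> borel_measurable (cpoisson \<nu>)"
    by (rule measurable_compose_countable[where f="\<lambda>n x. \<Prod>j<n. z (snd x j)" and g=fst]) measurable
  show i: "integrable (cpoisson \<nu>) (\<lambda>x. \<Prod>j<fst x. z (snd x j))"
    by (rule c.integrable_const_bound[where B=1])
      (auto intro!: AE_I2 prod_le_1 simp: z abs_prod)
  have iz: "integrable \<nu> z"
    by (rule \<nu>.integrable_const_bound[where B=1]) (auto simp: z)
  have "(\<integral>x. (\<Prod>j<fst x. z (snd x j)) \<partial>cpoisson \<nu>)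
    = (\<integral>N. (\<integral>p. (\<Prod>j<N. z (p j)) \<partial>PiM UNIV (\<lambda>_. \<nu>)) \<partial>measure_pmf (poisson_pmf 1))"
    using pp.integral_fst[of "\<lambda>N p. \<Prod>j<N. z (p j)"] i unfolding cpoisson_def
    by (simp add: case_prod_unfold)
  also have "\<dots> = (\<integral>N. (\<integral>p. z p \<partial>\<nu>) ^ N \<partial>measure_pmf (poisson_pmf 1))"
    using integral_PiM_prod(1)[where M="\<lambda>_::nat. \<nu>" and f="\<lambda>_. z", OF \<nu> _ iz]
    by simp
  finally show "(\<integral>x. (\<Prod>j<fst x. z (snd x j)) \<partial>cpoisson \<nu>) = exp ((\<integral>p. z p \<partial>\<nu>) - 1)"
    by (simp add: poisson_pgf)
qed

lemma exp_neg_suminf: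
  assumes y: "\<And>k. 0 \<le> (y k :: real)"
  shows "(\<lambda>n. exp (- (\<Sum>k<n. y k))) \<longlonglongrightarrow> exp_neg (\<Sum>k. ennreal (y k))"
proof (cases "summable y")
  case True
  then have "(\<Sum>k. ennreal (y k)) = ennreal (suminf y)"
    using y by (intro suminf_ennreal2) auto
  then show ?thesis
    using summable_LIMSEQ[OF True] suminf_nonneg[OF True y]
    by (auto simp: exp_neg_def intro!: tendsto_intros)
next
  case False
  then have e: "(\<Sum>k. ennreal (y k)) = \<infinity>"
    using y summable_suminf_not_top by auto
  have "filterlim (\<lambda>n. \<Sum>k<n. y k) at_top sequentially"
    unfolding filterlim_at_top
  proof
    fix Z
    have "\<not> (\<forall>n. (\<Sum>k<n. y k) \<le> Z)"
      using False y summableI_nonneg_bounded[of y Z] by blast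
    then obtain N where N: "Z < (\<Sum>k<N. y k)" by (meson not_le)
    have "Z \<le> (\<Sum>k<n. y k)" if "n \<ge> N" for n
      using N sum_mono2[of "{..<n}" "{..<N}" y] y that by auto
    then show "eventually (\<lambda>n. Z \<le> (\<Sum>k<n. y k)) sequentially"
      by (auto simp: eventually_sequentially)
  qed
  then have "(\<lambda>n. exp (- (\<Sum>k<n. y k))) \<longlonglongrightarrow> 0"
    by (intro filterlim_compose[OF exp_at_bot] filterlim_uminus_at_top[THEN iffD1])
  then show ?thesis by (simp add: exp_neg_def e)
qed

text \<open>Only the first \<open>fst (\<omega> k)\<close> marks of block \<open>k\<close> are
  points of the process. The weight depends on the block because the position of a point
  does.\<close>

definition config_sum :: "(nat \<Rightarrow> 'a \<Rightarrow> real) \<Rightarrow> (nat \<Rightarrow> nat \<times> (nat \<Rightarrow> 'a)) \<Rightarrow> ennreal" where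
  "config_sum w \<omega> = (\<Sum>k. ennreal (\<Sum>j<fst (\<omega> k). w k (snd (\<omega> k) j)))"

lemma measurable_config_sum [measurable]:
  assumes [measurable]: "\<And>k. w k \<in> borel_measurable \<nu>"
  shows "config_sum w \<in> borel_measurable (poisson_config \<nu>)"
proof -
  have "(\<lambda>\<omega>. \<Sum>j<fst (\<omega> k). w k (snd (\<omega> k) j)) \<in> borel_measurable (poisson_config \<nu>)" for k
    by (rule measurable_compose_countable[where f="\<lambda>n \<omega>. \<Sum>j<n. w k (snd (\<omega> k) j)" and g="\<lambda>\<omega>. fst (\<omega> k)"])
       measurable
  then show ?thesis unfolding config_sum_def[abs_def] by measurable
qed

text \<open>The Laplace functional of a Poisson process, with \<open>D\<close> the integral of
  \<open>1 - exp (- w)\<close> against the intensity: the blocks are independent, each contributes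
  one factor from \<open>cpoisson_pgf\<close>, and dominated convergence lets the number of blocks
  grow.\<close>

lemma config_laplace:
  assumes \<nu>: "prob_space \<nu>" and [measurable]: "\<And>k. w k \<in> borel_measurable \<nu>"
    and w: "\<And>k p. 0 \<le> w k p" and D: "0 \<le> D"
    "(\<Sum>k. \<integral>\<^sup>+p. ennreal (1 - exp (- w k p)) \<partial>\<nu>) = ennreal D"
  shows "(\<integral>\<omega>. exp_neg (config_sum w \<omega>) \<partial>poisson_config \<nu>) = exp (- D)"
proof -
  interpret \<nu>: prob_space \<nu> by fact
  interpret C: prob_space "poisson_config \<nu>" by (rule prob_space_poisson_config[OF \<nu>])
  define y where "y k x = (\<Sum>j<fst x. w k (snd x j))" for k and x :: "nat \<times> (nat \<Rightarrow> 'a)"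
  have y0: "0 \<le> y k x" for k x unfolding y_def by (intro sum_nonneg w)
  have ym [measurable]: "y k \<in> borel_measurable (cpoisson \<nu>)" for k
    unfolding y_def
    by (rule measurable_compose_countable[where f="\<lambda>n x. \<Sum>j<n. w k (snd x j)" and g=fst]) measurable
  have ym' [measurable]: "(\<lambda>\<omega>. y k (\<omega> k)) \<in> borel_measurable (poisson_config \<nu>)" for k
    unfolding poisson_config_def by measurable
  define d where "d k = (\<integral>p. 1 - exp (- w k p) \<partial>\<nu>)" for k
  have ie: "integrable \<nu> (\<lambda>p. exp (- w k p))" for k
    by (rule \<nu>.integrable_const_bound[where B=1]) (auto simp: w)
  have d0: "0 \<le> d k" for k unfolding d_def by (intro Bochner_Integration.integral_nonneg) (auto simp: w)
  have dk: "(\<integral>\<^sup>+p. ennreal (1 - exp (- w k p)) \<partial>\<nu>) = ennreal (d k)" for k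
    unfolding d_def using ie[of k] by (intro nn_integral_eq_integral) (auto simp: w)
  have dsum: "summable d"
    using D d0 unfolding dk by (intro summable_suminf_not_top) auto
  have "ennreal (suminf d) = ennreal D"
    using D d0 dsum unfolding dk by (subst suminf_ennreal2[symmetric]) auto
  then have dD: "suminf d = D"
    using D suminf_nonneg[OF dsum d0] by simp
  have ey: "exp (- y k x) = (\<Prod>j<fst x. exp (- w k (snd x j)))" for k x
    unfolding y_def by (simp add: exp_sum sum_negf[symmetric])
  have E: "(\<integral>x. exp (- y k x) \<partial>cpoisson \<nu>) = exp (- d k)" "integrable (cpoisson \<nu>) (\<lambda>x. exp (- y k x))" for k
    using cpoisson_pgf[OF \<nu>, of "\<lambda>p. exp (- w k p)"] ie[of k]
    unfolding ey by (auto simp: w d_def \<nu>.prob_space)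
  have eq: "(\<integral>\<omega>. exp (- (\<Sum>k<n. y k (\<omega> k))) \<partial>poisson_config \<nu>) = exp (- (\<Sum>k<n. d k))" for n
    using integral_PiM_prod(1)[where M="\<lambda>_::nat. cpoisson \<nu>" and f="\<lambda>k x. exp (- y k x)" and J="{..<n}",
        OF prob_space_cpoisson[OF \<nu>] _ E(2)]
    by (simp add: E exp_sum sum_negf[symmetric] poisson_config_def)
  have "(\<lambda>n. \<integral>\<omega>. exp (- (\<Sum>k<n. y k (\<omega> k))) \<partial>poisson_config \<nu>)
       \<longlonglongrightarrow> (\<integral>\<omega>. exp_neg (config_sum w \<omega>) \<partial>poisson_config \<nu>)"
  proof (rule integral_dominated_convergence[where w="\<lambda>_. 1"])
    show "AE \<omega> in poisson_config \<nu>. (\<lambda>n. exp (- (\<Sum>k<n. y k (\<omega> k)))) \<longlonglongrightarrow> exp_neg (config_sum w \<omega>)"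
      unfolding config_sum_def y_def[symmetric] by (intro AE_I2 exp_neg_suminf y0)
  qed (auto simp: y0 sum_nonneg)
  note this[unfolded eq]
  moreover have "(\<lambda>n. exp (- (\<Sum>k<n. d k))) \<longlonglongrightarrow> exp (- D)"
    using summable_LIMSEQ[OF dsum] unfolding dD by (intro tendsto_intros)
  ultimately show ?thesis by (rule LIMSEQ_unique)
qed

lemma config_sum_divide:
  assumes w: "\<And>k p. 0 \<le> w k p" and c: "0 < c"
  shows "config_sum (\<lambda>k p. w k p / c) \<omega> = config_sum w \<omega> / ennreal c"
proof -
  have "config_sum (\<lambda>k p. w k p / c) \<omega>
    = (\<Sum>k. ennreal (\<Sum>j<fst (\<omega> k). w k (snd (\<omega> k) j)) * ennreal (1 / c))"
    unfolding config_sum_def using c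
    by (intro arg_cong[where f=suminf] ext)
      (simp add: ennreal_mult'[symmetric] sum_nonneg w sum_divide_distrib)
  also have "\<dots> = config_sum w \<omega> * ennreal (1 / c)"
    unfolding config_sum_def by simp
  also have "ennreal (1 / c) = inverse (ennreal c)"
    using c by (simp add: inverse_ennreal inverse_eq_divide)
  finally show ?thesis by (simp add: divide_ennreal_def)
qed

text \<open>The Laplace transform at \<open>1 / Suc n\<close> tends to the probability that the sum
  is finite, because \<open>exp_neg\<close> of an infinite sum stays 0 under scaling. It also equals
  \<open>exp (- D n)\<close>, which tends to 1.\<close>

lemma AE_config_sum_finite:
  assumes \<nu>: "prob_space \<nu>" and [measurable]: "\<And>k. w k \<in> borel_measurable \<nu>"
    and w: "\<And>k p. 0 \<le> w k p" and D: "\<And>n. 0 \<le> D n"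
    "\<And>n. (\<Sum>k. \<integral>\<^sup>+p. ennreal (1 - exp (- (w k p / real (Suc n)))) \<partial>\<nu>) = ennreal (D n)"
    and D0: "D \<longlonglongrightarrow> 0"
  shows "AE \<omega> in poisson_config \<nu>. config_sum w \<omega> \<noteq> \<infinity>"
proof -
  interpret C: prob_space "poisson_config \<nu>" by (rule prob_space_poisson_config[OF \<nu>])
  let ?I = "indicator {\<omega>\<in>space (poisson_config \<nu>). config_sum w \<omega> \<noteq> \<infinity>} :: _ \<Rightarrow> real"
  have L: "(\<integral>\<omega>. exp_neg (config_sum w \<omega> / ennreal (real (Suc n))) \<partial>poisson_config \<nu>) = exp (- D n)" for n
    using config_laplace[OF \<nu>, of "\<lambda>k p. w k p / real (Suc n)" "D n"] D w
    by (subst config_sum_divide[symmetric]) auto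
  have "(\<lambda>n. \<integral>\<omega>. exp_neg (config_sum w \<omega> / ennreal (real (Suc n))) \<partial>poisson_config \<nu>)
      \<longlonglongrightarrow> (\<integral>\<omega>. ?I \<omega> \<partial>poisson_config \<nu>)"
  proof (rule integral_dominated_convergence[where w="\<lambda>_. 1"])
    show "AE \<omega> in poisson_config \<nu>.
       (\<lambda>n. exp_neg (config_sum w \<omega> / ennreal (real (Suc n)))) \<longlonglongrightarrow> ?I \<omega>"
    proof (rule AE_I2)
      fix \<omega> assume \<omega>: "\<omega> \<in> space (poisson_config \<nu>)"
      show "(\<lambda>n. exp_neg (config_sum w \<omega> / ennreal (real (Suc n)))) \<longlonglongrightarrow> ?I \<omega>"
      proof (cases "config_sum w \<omega>" rule: ennreal_cases)
        case (real r)
        have "exp_neg (config_sum w \<omega> / ennreal (real (Suc n))) = exp (- (r / real (Suc n)))" for n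
          using real by (simp add: divide_ennreal exp_neg_def del: of_nat_Suc)
        moreover have "(\<lambda>n. exp (- (r / real (Suc n)))) \<longlonglongrightarrow> exp (- 0)"
          by (intro tendsto_intros LIMSEQ_Suc[OF lim_const_over_n])
        ultimately show ?thesis using \<omega> real by simp
      next
        case top
        then show ?thesis by (simp add: exp_neg_def ennreal_top_divide del: of_nat_Suc)
      qed
    qed
  qed (auto simp: exp_neg_le_1)
  moreover have "(\<lambda>n. exp (- D n)) \<longlonglongrightarrow> exp (- 0)"
    by (intro tendsto_intros D0)
  ultimately have "(\<integral>\<omega>. ?I \<omega> \<partial>poisson_config \<nu>) = 1"
    unfolding L by (simp add: LIMSEQ_unique)
  then have "C.prob {\<omega>\<in>space (poisson_config \<nu>). config_sum w \<omega> \<noteq> \<infinity>} = 1"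
    by (simp add: Int_absorb2)
  then show ?thesis
    by (subst (asm) C.prob_Collect_eq_1) auto
qed

section \<open>Laplace exponents of positive stable sums\<close>

definition stable_const :: "real \<Rightarrow> real" where
  "stable_const \<beta> = enn2real (\<integral>\<^sup>+s. ennreal (1 - exp (- (s powr (- 1 / \<beta>)))) * indicator {0..} s \<partial>lborel)"

text \<open>The constant is Gamma(1 - \<beta>), but crude bounds above and below suffice: finiteness
  gives a finite Laplace exponent, and positivity allows dividing by the constant.\<close>

lemma stable_const:
  assumes \<beta>: "0 < \<beta>" "\<beta> < 1"
  shows "(\<integral>\<^sup>+s. ennreal (1 - exp (- (s powr (- 1 / \<beta>)))) * indicator {0..} s \<partial>lborel)
      = ennreal (stable_const \<beta>)" "0 < stable_const \<beta>"
proof -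
  let ?C = "\<integral>\<^sup>+s. ennreal (1 - exp (- (s powr (- 1 / \<beta>)))) * indicator {0..} s \<partial>lborel"
  have b: "- 1 / \<beta> < - 1" using \<beta> by (simp add: field_simps)
  \<comment> \<open>The integrand is at most 1 near 0, and at most
    \<open>s powr (- 1 / \<beta>)\<close> beyond 1 by \<open>1 - exp (- x) \<le> x\<close>; this
    power is integrable at infinity because \<open>\<beta> < 1\<close>.\<close>
  have "?C \<le> (\<integral>\<^sup>+s. indicator {0..1} s + ennreal (indicator {1..} s * (s powr (- 1 / \<beta>))) \<partial>lborel)"
  proof (intro nn_integral_mono)
    fix s :: real
    have "1 - exp (- (s powr (- 1 / \<beta>))) \<le> s powr (- 1 / \<beta>)"
      using exp_ge_add_one_self[of "- (s powr (- 1 / \<beta>))"] by linarith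
    then have "ennreal (1 - exp (- (s powr (- 1 / \<beta>)))) \<le> ennreal (s powr (- 1 / \<beta>))"
      by (rule ennreal_leI)
    moreover have "ennreal (1 - exp (- (s powr (- 1 / \<beta>)))) \<le> 1"
      by (rule ennreal_le_1[THEN iffD2]) simp
    ultimately show "ennreal (1 - exp (- (s powr (- 1 / \<beta>)))) * indicator {0..} s
        \<le> indicator {0..1} s + ennreal (indicator {1..} s * (s powr (- 1 / \<beta>)))"
      by (cases "s \<le> 1") (auto simp: indicator_def add_increasing2)
  qed
  also have "\<dots> = (\<integral>\<^sup>+s. indicator {0..1::real} s \<partial>lborel)
      + (\<integral>\<^sup>+s. ennreal (indicator {1..} s * (s powr (- 1 / \<beta>))) \<partial>lborel)"
    by (intro nn_integral_add) auto
  also have "(\<integral>\<^sup>+s. ennreal (indicator {1..} s * (s powr (- 1 / \<beta>))) \<partial>lborel)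
      = ennreal (- (1 powr (- 1 / \<beta> + 1)) / (- 1 / \<beta> + 1))"
    by (rule nn_integral_has_integral_lebesgue)
      (use has_integral_powr_to_inf[OF b, of 1] in auto)
  finally have fin: "?C < \<infinity>"
    by (rule le_less_trans) (simp add: ennreal_add_less_top)
  then show 1: "?C = ennreal (stable_const \<beta>)"
    unfolding stable_const_def by simp
  \<comment> \<open>\<open>e\<close> is the value of the integrand at 2, its minimum on the
    unit-length interval from 1 to 2.\<close>
  define e where "e = 1 - exp (- ((2::real) powr (- 1 / \<beta>)))"
  have e: "e > 0" unfolding e_def by simp
  have "ennreal e = (\<integral>\<^sup>+s. ennreal e * indicator {1..2::real} s \<partial>lborel)"
    by (subst nn_integral_cmult_indicator) auto
  also have "\<dots> \<le> ?C"
  proof (intro nn_integral_mono)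
    fix s :: real
    show "ennreal e * indicator {1..2::real} s \<le> ennreal (1 - exp (- (s powr (- 1 / \<beta>)))) * indicator {0..} s"
    proof (cases "s \<in> {1..2}")
      case True
      then have "2 powr (- 1 / \<beta>) \<le> s powr (- 1 / \<beta>)"
        using \<beta> by (intro powr_mono2') auto
      then show ?thesis using True unfolding e_def by (auto intro!: ennreal_leI)
    qed simp
  qed
  finally show "0 < stable_const \<beta>"
    unfolding 1 using e by (meson ennreal_le_iff2 less_le_trans not_le)
qed

text \<open>Substituting \<open>y powr \<beta> * s\<close> for \<open>s\<close> absorbs the factor
  \<open>y\<close> and leaves \<open>y powr \<beta>\<close> as the Jacobian.\<close>

lemma stable_const_scale:
  assumes \<beta>: "0 < \<beta>" "\<beta> < 1" and y: "0 \<le> y"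
  shows "(\<integral>\<^sup>+s. ennreal (1 - exp (- (s powr (- 1 / \<beta>) * y))) * indicator {0..} s \<partial>lborel)
      = ennreal (stable_const \<beta> * y powr \<beta>)"
proof (cases "y = 0")
  case False
  then have y: "0 < y" using y by simp
  have "(y powr \<beta> * s) powr (- 1 / \<beta>) * y = s powr (- 1 / \<beta>)" if "0 \<le> s" for s
  proof -
    have "(y powr \<beta> * s) powr (- 1 / \<beta>) * y = (y powr \<beta>) powr (- 1 / \<beta>) * s powr (- 1 / \<beta>) * y"
      using that by (simp add: powr_mult)
    also have "(y powr \<beta>) powr (- 1 / \<beta>) = 1 / y"
      using \<beta> y by (simp add: powr_powr powr_minus_divide)
    finally show ?thesis using y by simp
  qed
  then have "ennreal (1 - exp (- ((y powr \<beta> * s) powr (- 1 / \<beta>) * y))) * indicator {0..} (y powr \<beta> * s)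
      = ennreal (1 - exp (- (s powr (- 1 / \<beta>)))) * indicator {0..} s" for s
    using y by (cases "0 \<le> s") (auto simp: indicator_def zero_le_mult_iff)
  then have "(\<integral>\<^sup>+s. ennreal (1 - exp (- (s powr (- 1 / \<beta>) * y))) * indicator {0..} s \<partial>lborel)
     = ennreal (y powr \<beta>) * ennreal (stable_const \<beta>)"
    using y by (subst nn_integral_real_affine[where c="y powr \<beta>" and t=0]) (auto simp: stable_const(1)[OF \<beta>, simplified])
  then show ?thesis
    using stable_const(2)[OF \<beta>] by (simp add: ennreal_mult'[symmetric] mult_ac)
qed simp

text \<open>The arrival times of a unit rate Poisson process on the half line are produced interval by
  interval: in \<open>[k, k + 1)\<close> there are Poisson(1) many, independent and uniform.\<close>

definition unit_uniform :: "real measure" where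
  "unit_uniform = uniform_measure lborel {0..<1}"

lemma prob_space_unit_uniform: "prob_space unit_uniform"
  unfolding unit_uniform_def by (rule prob_space_uniform_measure) auto

lemma sets_unit_uniform [measurable_cong]: "sets unit_uniform = sets borel"
  by (simp add: unit_uniform_def)

text \<open>The shifted unit intervals tile the half line, so the blocks together have Lebesgue
  measure as intensity.\<close>

lemma nn_integral_unit_uniform_shifts:
  assumes [measurable]: "F \<in> borel_measurable borel"
  shows "(\<Sum>k. \<integral>\<^sup>+u. F (real k + u) \<partial>unit_uniform) = (\<integral>\<^sup>+s. F s * indicator {0..} s \<partial>lborel)"
proof -
  have "(\<integral>\<^sup>+u. F (real k + u) \<partial>unit_uniform) = (\<integral>\<^sup>+s. F s * indicator {real k..<real k + 1} s \<partial>lborel)" for k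
  proof -
    have "(\<integral>\<^sup>+u. F (real k + u) \<partial>unit_uniform) = (\<integral>\<^sup>+u. F (real k + u) * indicator {0..<1} u \<partial>lborel)"
      unfolding unit_uniform_def by (subst nn_integral_uniform_measure) (auto simp: divide_ennreal_def)
    also have "\<dots> = (\<integral>\<^sup>+s. F s * indicator {real k..<real k + 1} s \<partial>lborel)"
      by (subst nn_integral_real_affine[where c=1 and t="real k" and f="\<lambda>s. F s * indicator {real k..<real k + 1} s"])
        (auto intro!: nn_integral_cong simp: indicator_def)
    finally show ?thesis .
  qed
  then have "(\<Sum>k. \<integral>\<^sup>+u. F (real k + u) \<partial>unit_uniform)
      = (\<Sum>k. \<integral>\<^sup>+s. F s * indicator {real k..<real k + 1} s \<partial>lborel)" by simp
  also have "\<dots> = (\<integral>\<^sup>+s. F s * indicator (\<Union>k. {real k..<real k + 1}) s \<partial>lborel)"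
  proof (rule nn_integral_disjoint_family[symmetric])
    have "m = n" if "x \<in> {real m..<real m + 1}" "x \<in> {real n..<real n + 1}" for m n x
    proof -
      have "real m < real n + 1" "real n < real m + 1" using that by auto
      then show "m = n" by linarith
    qed
    then show "disjoint_family (\<lambda>k. {real k..<real k + 1})"
      unfolding disjoint_family_on_def by blast
  qed auto
  also have "(\<Union>k. {real k..<real k + 1}) = {0..}"
  proof (intro equalityI subsetI)
    fix s :: real assume "s \<in> {0..}"
    then have "s \<in> {real (nat \<lfloor>s\<rfloor>)..<real (nat \<lfloor>s\<rfloor>) + 1}" by simp
    then show "s \<in> (\<Union>k. {real k..<real k + 1})" by blast
  qed auto
  finally show ?thesis .
qed

text \<open>\<open>real k + fst p\<close> is the arrival time of a point of block \<open>k\<close>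
  and \<open>snd p\<close> its mark, so this is a term of the LePage series of index
  \<beta>.\<close>

definition stable_weight :: "real \<Rightarrow> ('a \<Rightarrow> real) \<Rightarrow> nat \<Rightarrow> real \<times> 'a \<Rightarrow> real" where
  "stable_weight \<beta> y k p = (real k + fst p) powr (- 1 / \<beta>) * y (snd p)"

text \<open>With the mark fixed, the blocks assemble to an integral over all arrival times, which
  \<open>stable_const_scale\<close> evaluates; the mark is integrated last.\<close>

lemma stable_weight_sum:
  assumes \<beta>: "0 < \<beta>" "\<beta> < 1" and "prob_space l"
    and [measurable]: "y \<in> borel_measurable l" and y: "\<And>v. 0 \<le> y v"
  shows "(\<Sum>k. \<integral>\<^sup>+p. ennreal (1 - exp (- stable_weight \<beta> y k p)) \<partial>(unit_uniform \<Otimes>\<^sub>M l))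
     = (\<integral>\<^sup>+v. ennreal (stable_const \<beta> * y v powr \<beta>) \<partial>l)"
proof -
  interpret l: prob_space l by fact
  interpret u: prob_space unit_uniform by (rule prob_space_unit_uniform)
  interpret pp: pair_sigma_finite unit_uniform l ..
  have "(\<integral>\<^sup>+p. ennreal (1 - exp (- stable_weight \<beta> y k p)) \<partial>(unit_uniform \<Otimes>\<^sub>M l))
    = (\<integral>\<^sup>+v. (\<integral>\<^sup>+u. ennreal (1 - exp (- ((real k + u) powr (- 1 / \<beta>) * y v))) \<partial>unit_uniform) \<partial>l)" for k
    unfolding stable_weight_def
    by (subst pp.nn_integral_snd[symmetric]) auto
  then have "(\<Sum>k. \<integral>\<^sup>+p. ennreal (1 - exp (- stable_weight \<beta> y k p)) \<partial>(unit_uniform \<Otimes>\<^sub>M l))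
    = (\<integral>\<^sup>+v. (\<Sum>k. \<integral>\<^sup>+u. ennreal (1 - exp (- ((real k + u) powr (- 1 / \<beta>) * y v))) \<partial>unit_uniform) \<partial>l)"
    by (simp, subst nn_integral_suminf) auto
  also have "\<dots> = (\<integral>\<^sup>+v. ennreal (stable_const \<beta> * y v powr \<beta>) \<partial>l)"
    by (intro nn_integral_cong,
        subst nn_integral_unit_uniform_shifts[where F="\<lambda>s. ennreal (1 - exp (- (s powr (- 1 / \<beta>) * y v)))" for v])
      (auto simp: stable_const_scale[OF \<beta> y, simplified])
  finally show ?thesis .
qed

text \<open>Dividing the weights by \<open>b\<close> replaces \<open>y\<close> by
  \<open>y / b\<close> and so divides the exponent by \<open>b powr \<beta>\<close>. The values
  \<open>b = Suc n\<close> give finiteness through \<open>AE_config_sum_finite\<close>, and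
  \<open>b = 1\<close> gives the Laplace transform.\<close>

lemma stable_config:
  assumes \<beta>: "0 < \<beta>" "\<beta> < 1" and l: "prob_space l"
    and [measurable]: "y \<in> borel_measurable l" and y: "\<And>v. 0 \<le> y v"
    and int: "integrable l (\<lambda>v. y v powr \<beta>)"
  shows "AE \<omega> in poisson_config (unit_uniform \<Otimes>\<^sub>M l). config_sum (stable_weight \<beta> y) \<omega> \<noteq> \<infinity>"
    and "(\<integral>\<omega>. exp_neg (config_sum (stable_weight \<beta> y) \<omega>) \<partial>poisson_config (unit_uniform \<Otimes>\<^sub>M l))
       = exp (- (stable_const \<beta> * (\<integral>v. y v powr \<beta> \<partial>l)))"
proof -
  note c = stable_const(2)[OF \<beta>]
  have \<nu>: "prob_space (unit_uniform \<Otimes>\<^sub>M l)"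
    by (intro prob_space_pair prob_space_unit_uniform l)
  have m [measurable]: "stable_weight \<beta> y k \<in> borel_measurable (unit_uniform \<Otimes>\<^sub>M l)" for k
    unfolding stable_weight_def by measurable
  have w: "0 \<le> stable_weight \<beta> y k p" for k p
    unfolding stable_weight_def using y by simp
  define J where "J = (\<integral>v. y v powr \<beta> \<partial>l)"
  have J: "0 \<le> J" unfolding J_def by (intro Bochner_Integration.integral_nonneg) simp
  have *: "(\<Sum>k. \<integral>\<^sup>+p. ennreal (1 - exp (- (stable_weight \<beta> y k p / b))) \<partial>(unit_uniform \<Otimes>\<^sub>M l))
     = ennreal (stable_const \<beta> * J / b powr \<beta>)" if b: "0 < b" for b
  proof -
    have e: "stable_weight \<beta> y k p / b = stable_weight \<beta> (\<lambda>v. y v / b) k p" for k p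
      unfolding stable_weight_def by simp
    have "(\<Sum>k. \<integral>\<^sup>+p. ennreal (1 - exp (- (stable_weight \<beta> y k p / b))) \<partial>(unit_uniform \<Otimes>\<^sub>M l))
      = (\<integral>\<^sup>+v. ennreal (stable_const \<beta> * (y v / b) powr \<beta>) \<partial>l)"
      unfolding e by (rule stable_weight_sum[OF \<beta> l]) (use y b in auto)
    also have "\<dots> = ennreal (\<integral>v. stable_const \<beta> / b powr \<beta> * y v powr \<beta> \<partial>l)"
      using y b c int by (subst nn_integral_eq_integral[symmetric])
        (auto simp: powr_divide intro!: nn_integral_cong integrable_mult_right)
    finally show ?thesis by (simp add: J_def)
  qed
  show "AE \<omega> in poisson_config (unit_uniform \<Otimes>\<^sub>M l). config_sum (stable_weight \<beta> y) \<omega> \<noteq> \<infinity>"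
  proof (rule AE_config_sum_finite[OF \<nu> m w])
    show "(\<Sum>k. \<integral>\<^sup>+p. ennreal (1 - exp (- (stable_weight \<beta> y k p / real (Suc n)))) \<partial>(unit_uniform \<Otimes>\<^sub>M l))
     = ennreal (stable_const \<beta> * J / real (Suc n) powr \<beta>)" for n
      by (rule *) simp
    show "0 \<le> stable_const \<beta> * J / real (Suc n) powr \<beta>" for n
      using c J by simp
    have "(\<lambda>n. stable_const \<beta> * J * real (Suc n) powr (- \<beta>)) \<longlonglongrightarrow> stable_const \<beta> * J * 0"
      using \<beta> by (intro tendsto_intros tendsto_neg_powr filterlim_compose[OF filterlim_real_sequentially filterlim_Suc]) auto
    then show "(\<lambda>n. stable_const \<beta> * J / real (Suc n) powr \<beta>) \<longlonglongrightarrow> 0"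
      by (simp add: powr_minus_divide)
  qed
  show "(\<integral>\<omega>. exp_neg (config_sum (stable_weight \<beta> y) \<omega>) \<partial>poisson_config (unit_uniform \<Otimes>\<^sub>M l))
       = exp (- (stable_const \<beta> * (\<integral>v. y v powr \<beta> \<partial>l)))"
    unfolding J_def[symmetric]
    using *[of 1] c J by (intro config_laplace[OF \<nu> m w]) auto
qed

section \<open>Existence of a measurable process with a given representation\<close>

text \<open>Comparison with twice the maximum covers \<open>\<alpha> < 1\<close> and
  \<open>\<alpha> \<ge> 1\<close> at once, at the price of the factor
  \<open>2 powr \<alpha>\<close>.\<close>

lemma abs_add_powr_le:
  fixes x y :: real
  assumes "0 < \<alpha>"
  shows "\<bar>x + y\<bar> powr \<alpha> \<le> 2 powr \<alpha> * (\<bar>x\<bar> powr \<alpha> + \<bar>y\<bar> powr \<alpha>)"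
proof -
  have "\<bar>x + y\<bar> powr \<alpha> \<le> (2 * max \<bar>x\<bar> \<bar>y\<bar>) powr \<alpha>"
    using assms by (intro powr_mono2) auto
  also have "\<dots> = 2 powr \<alpha> * (max \<bar>x\<bar> \<bar>y\<bar>) powr \<alpha>"
    by (rule powr_mult)
  also have "\<dots> \<le> 2 powr \<alpha> * (\<bar>x\<bar> powr \<alpha> + \<bar>y\<bar> powr \<alpha>)"
    by (intro mult_left_mono) (auto simp: max_def)
  finally show ?thesis .
qed

lemma in_Lalpha_add:
  assumes \<alpha>: "0 < \<alpha>" and "in_Lalpha \<alpha> \<mu> g" "in_Lalpha \<alpha> \<mu> h"
  shows "in_Lalpha \<alpha> \<mu> (\<lambda>x. g x + h x)"
proof -
  have [measurable]: "g \<in> borel_measurable \<mu>" "h \<in> borel_measurable \<mu>"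
    and i: "integrable \<mu> (\<lambda>x. 2 powr \<alpha> * (\<bar>g x\<bar> powr \<alpha> + \<bar>h x\<bar> powr \<alpha>))"
    using assms by (auto simp: in_Lalpha_def)
  have "integrable \<mu> (\<lambda>x. \<bar>g x + h x\<bar> powr \<alpha>)"
    by (rule Bochner_Integration.integrable_bound[OF i])
      (use abs_add_powr_le[OF \<alpha>] in \<open>auto intro!: AE_I2 order_trans[OF _ abs_ge_self]\<close>)
  then show ?thesis by (simp add: in_Lalpha_def)
qed

lemma in_Lalpha_mult: "in_Lalpha \<alpha> \<mu> h \<Longrightarrow> in_Lalpha \<alpha> \<mu> (\<lambda>x. c * h x)"
  by (auto simp: in_Lalpha_def abs_mult powr_mult)

lemma in_Lalpha_sum:
  fixes n :: nat
  assumes "0 < \<alpha>" and "\<And>j. in_Lalpha \<alpha> \<mu> (h j)"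
  shows "in_Lalpha \<alpha> \<mu> (\<lambda>x. \<Sum>j<n. \<theta> j * h j x)"
proof (induction n)
  case 0
  show ?case by (simp add: in_Lalpha_def)
next
  case (Suc n)
  then show ?case using assms by (simp add: in_Lalpha_add in_Lalpha_mult)
qed

text \<open>The LePage coefficients: \<open>prod_decode\<close> enumerates the points of all blocks,
  with 0 in the places beyond the number of points of a block. The factor 2 under the root cancels
  the 1/2 in the Gaussian characteristic function; \<open>r\<close> will correct for the law of the
  marks.\<close>

definition stable_coef ::
  "real \<Rightarrow> ('a \<Rightarrow> real) \<Rightarrow> ('a \<Rightarrow> real) \<Rightarrow> (nat \<Rightarrow> nat \<times> (nat \<Rightarrow> real \<times> 'a)) \<Rightarrow> nat \<Rightarrow> real" where
  "stable_coef \<beta> r h \<omega> i = (case prod_decode i of (k, j) \<Rightarrow>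
     if j < fst (\<omega> k) then sqrt (2 * stable_weight \<beta> r k (snd (\<omega> k) j)) * h (snd (snd (\<omega> k) j)) else 0)"

text \<open>On a fixed configuration the construction is linear in the kernel, so a combination of
  values of the field reduces to a single kernel.\<close>

lemma stable_coef_linear:
  "(\<Sum>j<n. \<theta> j * stable_coef \<beta> r (h j) \<omega> i) = stable_coef \<beta> r (\<lambda>v. \<Sum>j<n. \<theta> j * h j v) \<omega> i"
  by (cases "prod_decode i") (simp add: stable_coef_def sum_distrib_left mult_ac)

lemma stable_coef_sum:
  assumes r: "\<And>v. 0 \<le> r v"
  shows "(\<Sum>i. ennreal ((stable_coef \<beta> r h \<omega> i)\<^sup>2 / 2)) = config_sum (stable_weight \<beta> (\<lambda>v. r v * (h v)\<^sup>2)) \<omega>"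
proof -
  define f where "f = (\<lambda>(k, j). ennreal (if j < fst (\<omega> k)
     then stable_weight \<beta> (\<lambda>v. r v * (h v)\<^sup>2) k (snd (\<omega> k) j) else 0))"
  have w: "0 \<le> stable_weight \<beta> r k p" for k p
    using r unfolding stable_weight_def by simp
  have "ennreal ((stable_coef \<beta> r h \<omega> i)\<^sup>2 / 2) = f (prod_decode i)" for i
    using w by (cases "prod_decode i") (auto simp: f_def stable_coef_def power_mult_distrib stable_weight_def)
  then have "(\<Sum>i. ennreal ((stable_coef \<beta> r h \<omega> i)\<^sup>2 / 2)) = (\<Sum>i. f (prod_decode i))" by simp
  also have "\<dots> = (\<Sum>k. \<Sum>j. f (k, j))"
    by (rule suminf_ennreal_2dimen) simp
  also have "\<dots> = config_sum (stable_weight \<beta> (\<lambda>v. r v * (h v)\<^sup>2)) \<omega>"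
    unfolding config_sum_def
  proof (intro arg_cong[where f=suminf] ext)
    fix k
    have "(\<Sum>j. f (k, j)) = (\<Sum>j<fst (\<omega> k). f (k, j))"
      by (rule suminf_finite) (auto simp: f_def)
    also have "\<dots> = ennreal (\<Sum>j<fst (\<omega> k). stable_weight \<beta> (\<lambda>v. r v * (h v)\<^sup>2) k (snd (\<omega> k) j))"
      using r by (subst sum_ennreal[symmetric]) (auto simp: f_def stable_weight_def intro!: sum.cong)
    finally show "(\<Sum>j. f (k, j)) = ennreal (\<Sum>j<fst (\<omega> k). stable_weight \<beta> (\<lambda>v. r v * (h v)\<^sup>2) k (snd (\<omega> k) j))" .
  qed
  finally show ?thesis .
qed

text \<open>The second identity turns the conditional characteristic function of the Gaussian
  series, given the configuration, into the integrand of a Laplace transform.\<close>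

lemma stable_coef_square_summable:
  assumes r: "\<And>v. 0 \<le> r v"
    and fin: "config_sum (stable_weight \<beta> (\<lambda>v. r v * (h v)\<^sup>2)) \<omega> \<noteq> \<infinity>"
  shows "summable (\<lambda>i. (stable_coef \<beta> r h \<omega> i)\<^sup>2)"
    and "exp (- (\<Sum>i. (stable_coef \<beta> r h \<omega> i)\<^sup>2) / 2)
       = exp_neg (config_sum (stable_weight \<beta> (\<lambda>v. r v * (h v)\<^sup>2)) \<omega>)"
proof -
  let ?f = "\<lambda>i. (stable_coef \<beta> r h \<omega> i)\<^sup>2 / 2"
  note e = stable_coef_sum[OF r, where \<beta>=\<beta> and h=h and \<omega>=\<omega>]
  have s: "summable ?f"
    using fin unfolding e[symmetric] by (intro summable_suminf_not_top) auto
  show s': "summable (\<lambda>i. (stable_coef \<beta> r h \<omega> i)\<^sup>2)"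
    using summable_mult[OF s, of 2] by simp
  have "config_sum (stable_weight \<beta> (\<lambda>v. r v * (h v)\<^sup>2)) \<omega> = ennreal (suminf ?f)"
    unfolding e[symmetric] by (rule suminf_ennreal2[OF _ s]) simp
  moreover have "suminf ?f = (\<Sum>i. (stable_coef \<beta> r h \<omega> i)\<^sup>2) / 2"
    using suminf_divide[OF s', of 2] by simp
  moreover have "0 \<le> suminf ?f"
    by (rule suminf_nonneg[OF s]) simp
  ultimately show "exp (- (\<Sum>i. (stable_coef \<beta> r h \<omega> i)\<^sup>2) / 2)
       = exp_neg (config_sum (stable_weight \<beta> (\<lambda>v. r v * (h v)\<^sup>2)) \<omega>)"
    by (simp add: exp_neg_def)
qed

text \<open>Packs a configuration and the Gaussians into one sequence, the sample space fixed in
  \<open>represents_FSF\<close>. Row 0 holds the Gaussians; row \<open>Suc k\<close> holds the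
  number of points of block \<open>k\<close> in column 0 and its marks in the later columns.
  \<open>undefined\<close> fills the second component where only a real is stored.\<close>

definition encode_sample ::
  "(nat \<Rightarrow> nat \<times> (nat \<Rightarrow> real \<times> 'a)) \<times> (nat \<Rightarrow> real) \<Rightarrow> nat \<Rightarrow> real \<times> 'a" where
  "encode_sample = (\<lambda>(\<omega>, g) i. case prod_decode i of (k, j) \<Rightarrow>
     (case k of 0 \<Rightarrow> (g j, undefined) | Suc k \<Rightarrow>
       (case j of 0 \<Rightarrow> (real (fst (\<omega> k)), undefined) | Suc j \<Rightarrow> snd (\<omega> k) j)))"

lemma inj_encode_sample: "inj encode_sample"
proof (rule injI, clarify)
  fix \<omega> \<omega>' :: "nat \<Rightarrow> nat \<times> (nat \<Rightarrow> real \<times> 'a)" and g g' :: "nat \<Rightarrow> real"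
  assume e: "encode_sample (\<omega>, g) = encode_sample (\<omega>', g')"
  have g: "g j = g' j" for j
    using fun_cong[OF e, of "prod_encode (0, j)"] by (simp add: encode_sample_def)
  have "fst (\<omega> k) = fst (\<omega>' k)" for k
    using fun_cong[OF e, of "prod_encode (Suc k, 0)"] by (simp add: encode_sample_def)
  moreover have "snd (\<omega> k) j = snd (\<omega>' k) j" for k j
    using fun_cong[OF e, of "prod_encode (Suc k, Suc j)"] by (simp add: encode_sample_def)
  ultimately show "\<omega> = \<omega>' \<and> g = g'"
    using g by (auto simp: fun_eq_iff prod_eq_iff)
qed

text \<open>The LePage construction, with index \<open>\<beta> = \<alpha> / 2\<close> for the
  conditional variances: integrating out the Gaussians leaves \<open>exp_neg\<close> of a positive
  stable sum, whose mean \<open>stable_config\<close> evaluates.\<close>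

lemma stable_representation_exists_product:
  fixes \<mu> :: "'a measure" and h :: "'t::topological_space \<Rightarrow> 'a \<Rightarrow> real"
  assumes "sigma_finite_measure \<mu>" and \<alpha>: "0 < \<alpha>" "\<alpha> < 2"
    and hm: "jointly_measurable_kernel \<mu> h" and hL: "\<And>t. in_Lalpha \<alpha> \<mu> (h t)"
    and ne: "emeasure \<mu> (space \<mu>) \<noteq> 0"
  shows "\<exists>(M :: ((nat \<Rightarrow> nat \<times> (nat \<Rightarrow> real \<times> 'a)) \<times> (nat \<Rightarrow> real)) measure) Y.
    prob_space M \<and> measurable_field M Y \<and> stable_representation \<alpha> \<mu> h M Y"
proof -
  interpret \<mu>: sigma_finite_measure \<mu> by fact
  define \<beta> where "\<beta> = \<alpha> / 2"
  have \<beta>: "0 < \<beta>" "\<beta> < 1" using \<alpha> by (auto simp: \<beta>_def)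
  define C where "C = stable_const \<beta>"
  have C: "0 < C" unfolding C_def by (rule stable_const(2)[OF \<beta>])
  \<comment> \<open>The marks need a probability law while \<open>\<mu>\<close> may be infinite, so
    a positive integrable density is normalised. Its mass \<open>Z\<close> is positive because
    \<open>\<mu>\<close> is not the zero measure.\<close>
  obtain \<phi> :: "'a \<Rightarrow> real" where \<phi>: "\<phi> \<in> borel_measurable \<mu>" "\<And>x. \<phi> x > 0" "\<And>x. \<phi> x \<le> 1" "integrable \<mu> \<phi>"
    by (rule \<mu>.obtain_positive_integrable_function) blast
  note [measurable] = \<phi>(1)
  define Z where "Z = (\<integral>x. \<phi> x \<partial>\<mu>)"
  have "Z \<noteq> 0"
  proof
    assume "Z = 0"
    then have "AE x in \<mu>. \<phi> x = 0"
      using integral_nonneg_eq_0_iff_AE[OF \<phi>(4)] \<phi>(2) by (auto simp: Z_def intro: less_imp_le)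
    then have "AE x in \<mu>. False"
      by eventually_elim (use \<phi>(2) in \<open>simp add: less_le\<close>)
    then show False using ne by (simp add: AE_iff_measurable[OF sets.top] )
  qed
  moreover have "0 \<le> Z"
    unfolding Z_def using \<phi>(2) by (intro Bochner_Integration.integral_nonneg) (simp add: less_imp_le)
  ultimately have Z: "0 < Z" by simp
  define l where "l = density \<mu> (\<lambda>x. ennreal (\<phi> x / Z))"
  have sl [measurable_cong]: "sets l = sets \<mu>" by (simp add: l_def)
  have l: "prob_space l"
  proof
    have "emeasure l (space l) = (\<integral>\<^sup>+x. ennreal (\<phi> x / Z) \<partial>\<mu>)"
      unfolding l_def by (simp add: emeasure_density nn_integral_set_ennreal cong: nn_integral_cong)
    also have "\<dots> = ennreal (\<integral>x. \<phi> x / Z \<partial>\<mu>)"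
      using \<phi> Z by (intro nn_integral_eq_integral) (auto intro!: AE_I2 divide_nonneg_pos less_imp_le)
    finally show "emeasure l (space l) = 1" using Z by (simp add: Z_def)
  qed
  \<comment> \<open>\<open>r\<close> is chosen so that \<open>r v powr \<beta>\<close> cancels both
    the density \<open>\<phi> v / Z\<close> of \<open>l\<close> and the stable constant
    \<open>C\<close>.\<close>
  define r where "r v = (Z / \<phi> v / C) powr (1 / \<beta>)" for v
  have r: "0 \<le> r v" for v unfolding r_def by simp
  have [measurable]: "r \<in> borel_measurable \<mu>" unfolding r_def by measurable
  have weight: "(r v * (H v)\<^sup>2) powr \<beta> = Z / \<phi> v / C * \<bar>H v\<bar> powr \<alpha>" for v and H :: "'a \<Rightarrow> real"
  proof -
    have "(r v * (H v)\<^sup>2) powr \<beta> = r v powr \<beta> * ((H v)\<^sup>2) powr \<beta>"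
      by (rule powr_mult)
    also have "r v powr \<beta> = Z / \<phi> v / C"
      unfolding r_def using \<beta> Z C \<phi>(2)[of v] by (simp add: powr_powr)
    also have "((H v)\<^sup>2) powr \<beta> = \<bar>H v\<bar> powr \<alpha>"
    proof (cases "H v = 0")
      case False
      then have "((H v)\<^sup>2) powr \<beta> = (\<bar>H v\<bar> powr 2) powr \<beta>" by simp
      then show ?thesis unfolding powr_powr by (simp add: \<beta>_def)
    qed simp
    finally show ?thesis .
  qed
  define P where "P = poisson_config (unit_uniform \<Otimes>\<^sub>M l)"
  define M where "M = P \<Otimes>\<^sub>M gauss_seq"
  have Pp: "prob_space P"
    unfolding P_def by (intro prob_space_poisson_config prob_space_pair prob_space_unit_uniform l)
  interpret P: prob_space P by fact
  interpret G: prob_space gauss_seq by (rule prob_space_gauss_seq)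
  interpret PG: pair_sigma_finite P gauss_seq ..
  interpret M: prob_space M unfolding M_def by (intro prob_space_pair Pp prob_space_gauss_seq)
  have P_sets [measurable_cong]:
      "sets P = sets (PiM UNIV (\<lambda>_. count_space UNIV \<Otimes>\<^sub>M PiM UNIV (\<lambda>_. borel \<Otimes>\<^sub>M \<mu>)))"
    unfolding P_def sets_poisson_config
    by (intro sets_PiM_cong sets_pair_measure_cong refl sets_unit_uniform sl)
  have config: "AE \<omega> in P. config_sum (stable_weight \<beta> (\<lambda>v. r v * (H v)\<^sup>2)) \<omega> \<noteq> \<infinity>"
    "(\<integral>\<omega>. exp_neg (config_sum (stable_weight \<beta> (\<lambda>v. r v * (H v)\<^sup>2)) \<omega>) \<partial>P)
       = exp (- (\<integral>v. \<bar>H v\<bar> powr \<alpha> \<partial>\<mu>))"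
    if H: "in_Lalpha \<alpha> \<mu> H" for H
  proof -
    have [measurable]: "H \<in> borel_measurable \<mu>" and Hi: "integrable \<mu> (\<lambda>x. \<bar>H x\<bar> powr \<alpha>)"
      using H by (auto simp: in_Lalpha_def)
    have e: "(\<phi> v / Z) *\<^sub>R ((r v * (H v)\<^sup>2) powr \<beta>) = \<bar>H v\<bar> powr \<alpha> / C" for v
      unfolding weight using Z \<phi>(2)[of v] by simp
    have i: "integrable l (\<lambda>v. (r v * (H v)\<^sup>2) powr \<beta>)"
      unfolding l_def using Z \<phi>(2) Hi by (subst integrable_density) (auto simp: e less_imp_le simp del: real_scaleR_def)
    have "(\<integral>v. (r v * (H v)\<^sup>2) powr \<beta> \<partial>l) = (\<integral>v. \<bar>H v\<bar> powr \<alpha> \<partial>\<mu>) / C"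
      unfolding l_def using Z \<phi>(2) by (subst integral_density) (auto simp: e less_imp_le simp del: real_scaleR_def)
    then have I: "stable_const \<beta> * (\<integral>v. (r v * (H v)\<^sup>2) powr \<beta> \<partial>l) = (\<integral>v. \<bar>H v\<bar> powr \<alpha> \<partial>\<mu>)"
      using C by (simp add: C_def)
    note * = stable_config[OF \<beta> l, of "\<lambda>v. r v * (H v)\<^sup>2", OF _ _ i, folded P_def, unfolded I]
    show "AE \<omega> in P. config_sum (stable_weight \<beta> (\<lambda>v. r v * (H v)\<^sup>2)) \<omega> \<noteq> \<infinity>"
      by (rule *(1)) (auto simp: r)
    show "(\<integral>\<omega>. exp_neg (config_sum (stable_weight \<beta> (\<lambda>v. r v * (H v)\<^sup>2)) \<omega>) \<partial>P)
       = exp (- (\<integral>v. \<bar>H v\<bar> powr \<alpha> \<partial>\<mu>))"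
      by (rule *(2)) (auto simp: r)
  qed
  define Y where "Y t = (\<lambda>(\<omega>, g). gsum (stable_coef \<beta> r (h t) \<omega>) g)" for t
  have hm' [measurable (raw)]: "(\<lambda>x. h (a x) (b x)) \<in> borel_measurable N"
    if "a \<in> N \<rightarrow>\<^sub>M borel" "b \<in> N \<rightarrow>\<^sub>M \<mu>" for a b and N :: "'z measure"
    using measurable_compose[OF measurable_Pair[OF that] hm[unfolded jointly_measurable_kernel_def]]
    by simp
  \<comment> \<open>The index enters through the measurable map \<open>a\<close>, so this is joint
    measurability in index and configuration.\<close>
  have coefm: "(\<lambda>x. stable_coef \<beta> r (h (a x)) (b x) i) \<in> borel_measurable N"
    if a: "a \<in> N \<rightarrow>\<^sub>M borel" and b: "b \<in> N \<rightarrow>\<^sub>M P" for a b i and N :: "'z measure"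
  proof -
    obtain k j where kj: "prod_decode i = (k, j)" by fastforce
    have "(\<lambda>\<omega>. \<omega> k) \<in> P \<rightarrow>\<^sub>M count_space UNIV \<Otimes>\<^sub>M PiM UNIV (\<lambda>_. borel \<Otimes>\<^sub>M \<mu>)"
      unfolding measurable_cong_sets[OF P_sets refl] by measurable
    then have bk: "(\<lambda>x. b x k) \<in> N \<rightarrow>\<^sub>M count_space UNIV \<Otimes>\<^sub>M PiM UNIV (\<lambda>_. borel \<Otimes>\<^sub>M \<mu>)"
      by (rule measurable_compose[OF b])
    have [measurable]: "(\<lambda>x. fst (b x k)) \<in> N \<rightarrow>\<^sub>M count_space UNIV"
      by (rule measurable_compose[OF bk measurable_fst])
    have pt: "(\<lambda>x. snd (b x k) j) \<in> N \<rightarrow>\<^sub>M borel \<Otimes>\<^sub>M \<mu>"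
      by (rule measurable_compose[OF measurable_compose[OF bk measurable_snd] measurable_component_singleton]) simp
    have [measurable]: "(\<lambda>x. fst (snd (b x k) j)) \<in> borel_measurable N"
      by (rule measurable_compose[OF pt measurable_fst])
    have v [measurable]: "(\<lambda>x. snd (snd (b x k) j)) \<in> N \<rightarrow>\<^sub>M \<mu>"
      by (rule measurable_compose[OF pt measurable_snd])
    have [measurable]: "(\<lambda>x. h (a x) (snd (snd (b x k) j))) \<in> borel_measurable N"
      by (rule hm'[OF a v])
    have [measurable]: "(\<lambda>x. r (snd (snd (b x k) j))) \<in> borel_measurable N"
      by (rule measurable_compose[OF v]) measurable
    show ?thesis
      unfolding stable_coef_def kj stable_weight_def prod.case by measurable
  qed
  have Yfield: "measurable_field M Y"
    unfolding measurable_field_def Y_def case_prod_unfold M_def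
    by (intro measurable_gsum coefm) measurable
  have Ym [measurable]: "Y t \<in> borel_measurable M" for t
    using measurable_compose[OF measurable_Pair1' Yfield[unfolded measurable_field_def], of t] by simp
  have "(CLINT x|M. iexp (\<Sum>j<n. \<theta> j * Y (s j) x))
      = complex_of_real (exp (- (LINT x|\<mu>. \<bar>\<Sum>j<n. \<theta> j * h (s j) x\<bar> powr \<alpha>)))"
    (is "?lhs = ?rhs") for n :: nat and \<theta> :: "nat \<Rightarrow> real" and s
  proof -
    define H where "H = (\<lambda>v. \<Sum>j<n. \<theta> j * h (s j) v)"
    have HL: "in_Lalpha \<alpha> \<mu> H"
      unfolding H_def by (intro in_Lalpha_sum hL) (use \<alpha> in auto)
    define F where "F x = iexp (\<Sum>j<n. \<theta> j * Y (s j) x)" for x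
    have F: "F \<in> borel_measurable M"
      unfolding F_def by measurable
    have Fi: "integrable M F"
      unfolding F_def by (rule M.integrable_iexp) auto
    \<comment> \<open>The Gaussians are integrated out first, for a fixed configuration.\<close>
    have "?lhs = (CLINT \<omega>|P. CLINT g|gauss_seq. F (\<omega>, g))"
      using PG.integral_fst[of "\<lambda>\<omega> g. F (\<omega>, g)"] Fi unfolding M_def F_def[symmetric] by simp
    also have "\<dots> = (CLINT \<omega>|P. complex_of_real (exp_neg (config_sum (stable_weight \<beta> (\<lambda>v. r v * (H v)\<^sup>2)) \<omega>)))"
    proof (rule integral_cong_AE)
      \<comment> \<open>\<open>gsum_char\<close> requires square summability for every
        \<open>s j\<close>; finiteness for the combination \<open>H\<close> is a further almost sure
        event.\<close>
      have "AE \<omega> in P. \<forall>j\<in>{..<n}. config_sum (stable_weight \<beta> (\<lambda>v. r v * (h (s j) v)\<^sup>2)) \<omega> \<noteq> \<infinity>"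
        by (rule AE_finite_allI) (auto intro!: config hL simp del: infinity_ennreal_def)
      with config(1)[OF HL]
      show "AE \<omega> in P. (CLINT g|gauss_seq. F (\<omega>, g))
         = complex_of_real (exp_neg (config_sum (stable_weight \<beta> (\<lambda>v. r v * (H v)\<^sup>2)) \<omega>))"
      proof eventually_elim
        case (elim \<omega>)
        then have "summable (\<lambda>i. (stable_coef \<beta> r (h (s j)) \<omega> i)\<^sup>2)" if "j < n" for j
          using that by (intro stable_coef_square_summable(1)[OF r]) auto
        from gsum_char(2)[OF this, where \<theta>=\<theta>]
        show ?case
          unfolding F_def Y_def prod.case stable_coef_linear
          using stable_coef_square_summable(2)[OF r elim(1)] by (simp add: H_def)
      qed
      show "(\<lambda>\<omega>. CLINT g|gauss_seq. F (\<omega>, g)) \<in> borel_measurable P"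
        using F unfolding M_def by measurable
      have [measurable]: "H \<in> borel_measurable \<mu>" using HL by (simp add: in_Lalpha_def)
      have "config_sum (stable_weight \<beta> (\<lambda>v. r v * (H v)\<^sup>2)) \<in> borel_measurable P"
        unfolding P_def stable_weight_def by (rule measurable_config_sum) measurable
      then show "(\<lambda>\<omega>. complex_of_real (exp_neg (config_sum (stable_weight \<beta> (\<lambda>v. r v * (H v)\<^sup>2)) \<omega>)))
          \<in> borel_measurable P" by measurable
    qed
    also have "\<dots> = complex_of_real (exp (- (\<integral>v. \<bar>H v\<bar> powr \<alpha> \<partial>\<mu>)))"
      unfolding integral_complex_of_real config(2)[OF HL] ..
    finally show ?thesis by (simp add: H_def)
  qed
  then have "stable_representation \<alpha> \<mu> h M Y"
    unfolding stable_representation_def using assms by blast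
  then show ?thesis using Yfield M.prob_space_axioms by blast
qed

text \<open>The injection \<open>encode_sample\<close> carries the construction over to the required
  sample space. The embedded measure makes both the injection and its inverse measurable, so the
  field is read off by decoding.\<close>

lemma stable_representation_exists:
  fixes \<mu> :: "'a measure" and h :: "'t::topological_space \<Rightarrow> 'a \<Rightarrow> real"
  assumes \<mu>: "sigma_finite_measure \<mu>" and \<alpha>: "0 < \<alpha>" "\<alpha> < 2"
    and hm: "jointly_measurable_kernel \<mu> h" and hL: "\<And>t. in_Lalpha \<alpha> \<mu> (h t)"
  shows "\<exists>(Q :: (nat \<Rightarrow> real \<times> 'a) measure) Y.
    prob_space Q \<and> measurable_field Q Y \<and> stable_representation \<alpha> \<mu> h Q Y"
proof (cases "emeasure \<mu> (space \<mu>) = 0")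
  case True
  then have "AE x in \<mu>. False"
    by (simp add: AE_iff_measurable[OF sets.top])
  then have 0: "(LINT x|\<mu>. \<bar>\<Sum>j<n. \<theta> j * h (s j) x\<bar> powr \<alpha>) = 0" for n :: nat and \<theta> s
    by (intro integral_eq_zero_AE) auto
  \<comment> \<open>For the zero measure all exponents vanish, and the zero field under a point mass
    serves; \<open>undefined\<close> is just some point.\<close>
  let ?Q = "return (count_space UNIV) undefined :: (nat \<Rightarrow> real \<times> 'a) measure"
  interpret Q: prob_space ?Q by (rule prob_space_return) simp
  have "prob_space ?Q \<and> measurable_field ?Q (\<lambda>_ _. 0) \<and> stable_representation \<alpha> \<mu> h ?Q (\<lambda>_ _. 0)"
    using Q.prob_space_axioms \<mu> hL 0 Q.prob_space
    by (simp add: measurable_field_def stable_representation_def)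
  then show ?thesis by blast
next
  case False
  obtain M :: "((nat \<Rightarrow> nat \<times> (nat \<Rightarrow> real \<times> 'a)) \<times> (nat \<Rightarrow> real)) measure" and Y
    where M: "prob_space M" "measurable_field M Y" "stable_representation \<alpha> \<mu> h M Y"
    using stable_representation_exists_product[OF \<mu> \<alpha> hm hL False] by blast
  let ?e = "encode_sample :: _ \<Rightarrow> nat \<Rightarrow> real \<times> 'a"
  define Q where "Q = embed_measure M ?e"
  have e [measurable]: "?e \<in> M \<rightarrow>\<^sub>M Q"
    unfolding Q_def by (rule measurable_embed_measure2[OF inj_encode_sample])
  have Qd: "Q = distr M Q ?e"
    unfolding Q_def by (rule embed_measure_eq_distr[OF inj_encode_sample])
  define D where "D = inv ?e"
  have D: "D (?e x) = x" for x unfolding D_def by (rule inv_f_f[OF inj_encode_sample])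
  have Dm [measurable]: "D \<in> Q \<rightarrow>\<^sub>M M"
    unfolding Q_def by (rule measurable_embed_measure1) (simp add: D)
  note Yf [measurable] = M(2)[unfolded measurable_field_def]
  have f: "measurable_field Q (\<lambda>t q. Y t (D q))"
    unfolding measurable_field_def
    using measurable_compose[OF _ Yf, of "\<lambda>x. (fst x, D (snd x))" "borel \<Otimes>\<^sub>M Q"]
    by (simp add: case_prod_unfold)
  have Ym [measurable]: "Y t \<in> borel_measurable M" for t
    using measurable_compose[OF measurable_Pair1' Yf, of t] by simp
  have "(CLINT q|Q. iexp (\<Sum>j<n. \<theta> j * Y (s j) (D q))) = (CLINT x|M. iexp (\<Sum>j<n. \<theta> j * Y (s j) x))"
    for n :: nat and \<theta> s
    by (subst Qd, subst integral_distr[OF e]) (measurable, simp add: D)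
  then have "stable_representation \<alpha> \<mu> h Q (\<lambda>t q. Y t (D q))"
    using M(3) unfolding stable_representation_def by simp
  moreover have "prob_space Q"
    using prob_space.prob_space_distr[OF M(1) e] Qd by simp
  ultimately show ?thesis using f by blast
qed

section \<open>The Cramer-Wold device\<close>

text \<open>Levy uniqueness for the laws of \<open>X\<close> and \<open>X'\<close> under the weights
  \<open>f\<close> and \<open>f'\<close>, normalised to mass one. The transforms at
  \<open>u = 0\<close> show that both masses equal \<open>c\<close>; if \<open>c = 0\<close>, both
  sides vanish.\<close>

lemma indicator_integral_eq_of_char_eq:
  fixes X :: "'a \<Rightarrow> real" and X' :: "'b \<Rightarrow> real" and f :: "'a \<Rightarrow> real" and f' :: "'b \<Rightarrow> real"
  assumes [measurable]: "X \<in> borel_measurable M" "X' \<in> borel_measurable M'"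
    and f: "integrable M f" "\<And>x. 0 \<le> f x" and f': "integrable M' f'" "\<And>x. 0 \<le> f' x"
    and eq: "\<And>u. (CLINT x|M. f x * iexp (u * X x)) = (CLINT x|M'. f' x * iexp (u * X' x))"
    and A [measurable]: "A \<in> sets borel"
  shows "(\<integral>x. f x * indicator A (X x) \<partial>M) = (\<integral>x. f' x * indicator A (X' x) \<partial>M')"
proof -
  define c where "c = (\<integral>x. f x \<partial>M)"
  have c': "(\<integral>x. f' x \<partial>M') = c"
    using eq[of 0] by (simp add: c_def)
  show ?thesis
  proof (cases "c = 0")
    case True
    then have "AE x in M. f x = 0" "AE x in M'. f' x = 0"
      using integral_nonneg_eq_0_iff_AE[OF f(1)] integral_nonneg_eq_0_iff_AE[OF f'(1)] f(2) f'(2)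
      by (auto simp: c' c_def[symmetric])
    then have "AE x in M. f x * indicator A (X x) = 0" "AE x in M'. f' x * indicator A (X' x) = 0"
      by (auto elim: eventually_mono)
    then show ?thesis
      by (simp add: integral_eq_zero_AE)
  next
    case False
    moreover have "0 \<le> c" unfolding c_def using f by (intro Bochner_Integration.integral_nonneg)
    ultimately have c: "0 < c" by simp
    have law: "real_distribution (distr (density N (\<lambda>x. ennreal (g x / c))) borel V) \<and>
       (\<forall>u. char (distr (density N (\<lambda>x. ennreal (g x / c))) borel V) u = (CLINT x|N. g x * iexp (u * V x)) / c) \<and>
       measure (distr (density N (\<lambda>x. ennreal (g x / c))) borel V) A = (\<integral>x. g x * indicator A (V x) \<partial>N) / c"
      if V [measurable]: "V \<in> borel_measurable N" and g: "integrable N g" "\<And>x. 0 \<le> g x" "(\<integral>x. g x \<partial>N) = c"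
      for N :: "'z measure" and g V
    proof -
      note [measurable] = borel_measurable_integrable[OF g(1)]
      let ?D = "density N (\<lambda>x. ennreal (g x / c))"
      have "emeasure ?D (space ?D) = (\<integral>\<^sup>+x. ennreal (g x / c) \<partial>N)"
        by (simp add: emeasure_density cong: nn_integral_cong)
      also have "\<dots> = ennreal (\<integral>x. g x / c \<partial>N)"
        using g c by (intro nn_integral_eq_integral) auto
      finally have "prob_space ?D" using c by (intro prob_spaceI) (simp add: g)
      then interpret D: prob_space ?D .
      interpret R: real_distribution "distr ?D borel V"
        by (rule D.real_distribution_distr) simp
      have "char (distr ?D borel V) u = (CLINT x|N. g x * iexp (u * V x)) / c" for u
      proof -
        have "char (distr ?D borel V) u = (CLINT x|?D. iexp (u * V x))"
          unfolding char_def by (subst integral_distr) auto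
        also have "\<dots> = (CLINT x|N. (g x * iexp (u * V x)) / c)"
          using g c by (subst integral_density) (auto simp: scaleR_conv_of_real)
        finally show ?thesis by simp
      qed
      moreover have "measure (distr ?D borel V) A = (\<integral>x. g x * indicator A (V x) \<partial>N) / c"
      proof -
        have "measure (distr ?D borel V) A = (\<integral>x. indicator A x \<partial>distr ?D borel V)" by simp
        also have "\<dots> = (\<integral>x. indicator A (V x) \<partial>?D)"
          by (subst integral_distr) auto
        also have "\<dots> = (\<integral>x. g x * indicator A (V x) / c \<partial>N)"
          using g c by (subst integral_density) auto
        finally show ?thesis by simp
      qed
      ultimately show ?thesis using R.real_distribution_axioms by blast
    qed
    note L = law[OF assms(1) f c_def[symmetric]] and L' = law[OF assms(2) f' c']
    have "distr (density M (\<lambda>x. ennreal (f x / c))) borel X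
        = distr (density M' (\<lambda>x. ennreal (f' x / c))) borel X'"
      by (rule Levy_uniqueness) (use L L' eq in auto)
    then show ?thesis using L L' c by auto
  qed
qed

text \<open>Splits the complex weight \<open>W e\<^sup>i\<^sup>Y\<close> into the nonnegative ones \<open>W\<close>, \<open>W (1 + cos Y)\<close>
  and \<open>W (1 + sin Y)\<close>.\<close>

lemma indicator_integral_eq_of_char_eq_complex:
  fixes X Y W :: "'a \<Rightarrow> real" and X' Y' W' :: "'b \<Rightarrow> real"
  assumes m [measurable]: "X \<in> borel_measurable M" "X' \<in> borel_measurable M'"
      "Y \<in> borel_measurable M" "Y' \<in> borel_measurable M'"
    and W: "integrable M W" "\<And>x. 0 \<le> W x" and W': "integrable M' W'" "\<And>x. 0 \<le> W' x"
    and eq: "\<And>a u. (CLINT x|M. W x * iexp (a * Y x + u * X x)) = (CLINT x|M'. W' x * iexp (a * Y' x + u * X' x))"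
    and A [measurable]: "A \<in> sets borel"
  shows "(CLINT x|M. complex_of_real (W x * indicator A (X x)) * iexp (Y x))
    = (CLINT x|M'. complex_of_real (W' x * indicator A (X' x)) * iexp (Y' x))"
proof -
  note [measurable] = borel_measurable_integrable[OF W(1)] borel_measurable_integrable[OF W'(1)]
  have bnd: "integrable N (\<lambda>x. complex_of_real (V x) * g x)"
    if "integrable N V" "g \<in> borel_measurable N" "\<And>x. cmod (g x) \<le> 1"
    for N :: "'z measure" and V g
    using that by (intro Bochner_Integration.integrable_bound[OF that(1)])
      (auto simp: norm_mult intro!: AE_I2 mult_left_le)
  have rbnd: "integrable N (\<lambda>x. V x * g x)"
    if "integrable N V" "g \<in> borel_measurable N" "\<And>x. \<bar>g x\<bar> \<le> 2"
    for N :: "'z measure" and V g :: "'z \<Rightarrow> real"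
  proof (rule Bochner_Integration.integrable_bound[OF integrable_mult_right[OF that(1), of 2]])
    show "AE x in N. norm (V x * g x) \<le> norm (2 * V x)"
      using that(3) by (auto simp: abs_mult mult.commute[of 2] intro!: AE_I2 mult_left_mono)
  qed (use that in auto)
  have cosb: "\<bar>1 + cos y\<bar> \<le> 2" "\<bar>1 + sin y\<bar> \<le> 2" "0 \<le> 1 + cos y" "0 \<le> 1 + sin y" for y :: real
    using cos_ge_minus_one[of y] cos_le_one[of y] sin_ge_minus_one[of y] sin_le_one[of y]
    by (auto simp: abs_le_iff simp del: cos_ge_minus_one cos_le_one sin_ge_minus_one sin_le_one)
  have ie: "integrable N (\<lambda>x. complex_of_real (V x) * iexp (v x))"
    if "integrable N V" "v \<in> borel_measurable N"
    for N :: "'z measure" and V v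
    using that by (intro bnd) auto
  \<comment> \<open>Cosine and sine split into exponentials, so the transforms of the new weights
    are combinations of those in \<open>eq\<close> at \<open>a = 0\<close>, \<open>1\<close> and
    \<open>- 1\<close>.\<close>
  have cs: "(CLINT x|N. complex_of_real (V x * (1 + cos (S x))) * iexp (u * T x))
        = (CLINT x|N. V x * iexp (0 * S x + u * T x)) +
          ((CLINT x|N. V x * iexp (1 * S x + u * T x)) + (CLINT x|N. V x * iexp (- 1 * S x + u * T x))) / 2"
     "(CLINT x|N. complex_of_real (V x * (1 + sin (S x))) * iexp (u * T x))
        = (CLINT x|N. V x * iexp (0 * S x + u * T x)) +
          ((CLINT x|N. V x * iexp (1 * S x + u * T x)) - (CLINT x|N. V x * iexp (- 1 * S x + u * T x))) / (2 * \<i>)"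
    if V: "integrable N V" and [measurable]: "S \<in> borel_measurable N" "T \<in> borel_measurable N"
    for N :: "'z measure" and V S T u
  proof -
    have e1: "complex_of_real (V x * (1 + cos (S x))) * iexp (u * T x)
       = V x * iexp (0 * S x + u * T x) +
         (V x * iexp (1 * S x + u * T x) + V x * iexp (- 1 * S x + u * T x)) / 2" for x
      by (simp add: cos_exp_eq cos_of_real[symmetric] exp_add[symmetric] algebra_simps add_divide_distrib)
    have e2: "complex_of_real (V x * (1 + sin (S x))) * iexp (u * T x)
       = V x * iexp (0 * S x + u * T x) +
         (V x * iexp (1 * S x + u * T x) - V x * iexp (- 1 * S x + u * T x)) / (2 * \<i>)" for x
      by (simp add: sin_exp_eq sin_of_real[symmetric] exp_add[symmetric] algebra_simps diff_divide_distrib)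
    have i: "integrable N (\<lambda>x. V x * iexp (a * S x + u * T x))" for a
      by (rule ie[OF V]) measurable
    show "(CLINT x|N. complex_of_real (V x * (1 + cos (S x))) * iexp (u * T x))
        = (CLINT x|N. V x * iexp (0 * S x + u * T x)) +
          ((CLINT x|N. V x * iexp (1 * S x + u * T x)) + (CLINT x|N. V x * iexp (- 1 * S x + u * T x))) / 2"
      unfolding e1
      by (subst Bochner_Integration.integral_add[OF i Bochner_Integration.integrable_divide[OF Bochner_Integration.integrable_add[OF i i]]],
          subst integral_divide_zero, subst Bochner_Integration.integral_add[OF i i], rule refl)
    show "(CLINT x|N. complex_of_real (V x * (1 + sin (S x))) * iexp (u * T x))
        = (CLINT x|N. V x * iexp (0 * S x + u * T x)) +
          ((CLINT x|N. V x * iexp (1 * S x + u * T x)) - (CLINT x|N. V x * iexp (- 1 * S x + u * T x))) / (2 * \<i>)"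
      unfolding e2
      by (subst Bochner_Integration.integral_add[OF i Bochner_Integration.integrable_divide[OF Bochner_Integration.integrable_diff[OF i i]]],
          subst integral_divide_zero, subst Bochner_Integration.integral_diff[OF i i], rule refl)
  qed
  have 0: "(\<integral>x. W x * indicator A (X x) \<partial>M) = (\<integral>x. W' x * indicator A (X' x) \<partial>M')"
    using eq[of 0] by (intro indicator_integral_eq_of_char_eq W W') auto
  have 1: "(\<integral>x. (W x * (1 + cos (Y x))) * indicator A (X x) \<partial>M) = (\<integral>x. (W' x * (1 + cos (Y' x))) * indicator A (X' x) \<partial>M')"
  proof (rule indicator_integral_eq_of_char_eq[OF m(1,2)])
    show "(CLINT x|M. complex_of_real (W x * (1 + cos (Y x))) * iexp (u * X x))
        = (CLINT x|M'. complex_of_real (W' x * (1 + cos (Y' x))) * iexp (u * X' x))" for u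
      unfolding cs(1)[OF W(1) m(3,1)] cs(1)[OF W'(1) m(4,2)] eq ..
  qed (auto intro!: rbnd mult_nonneg_nonneg W W' cosb)
  have 2: "(\<integral>x. (W x * (1 + sin (Y x))) * indicator A (X x) \<partial>M) = (\<integral>x. (W' x * (1 + sin (Y' x))) * indicator A (X' x) \<partial>M')"
  proof (rule indicator_integral_eq_of_char_eq[OF m(1,2)])
    show "(CLINT x|M. complex_of_real (W x * (1 + sin (Y x))) * iexp (u * X x))
        = (CLINT x|M'. complex_of_real (W' x * (1 + sin (Y' x))) * iexp (u * X' x))" for u
      unfolding cs(2)[OF W(1) m(3,1)] cs(2)[OF W'(1) m(4,2)] eq ..
  qed (auto intro!: rbnd mult_nonneg_nonneg W W' cosb)
  \<comment> \<open>The way back: subtracting the integral with weight \<open>V\<close> removes the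
    constants 1, and Euler's formula reassembles \<open>iexp\<close>.\<close>
  have dec: "(CLINT x|N. complex_of_real (V x * indicator A (T x)) * iexp (S x))
     = complex_of_real ((\<integral>x. (V x * (1 + cos (S x))) * indicator A (T x) \<partial>N) - (\<integral>x. V x * indicator A (T x) \<partial>N))
     + \<i> * complex_of_real ((\<integral>x. (V x * (1 + sin (S x))) * indicator A (T x) \<partial>N) - (\<integral>x. V x * indicator A (T x) \<partial>N))"
    if V: "integrable N V" and [measurable]: "S \<in> borel_measurable N" "T \<in> borel_measurable N"
    for N :: "'z measure" and V S T
  proof -
    have i0: "integrable N (\<lambda>x. V x * indicator A (T x))"
      by (intro rbnd V) (auto simp: indicator_def)
    have i1: "integrable N (\<lambda>x. (V x * (1 + cos (S x))) * indicator A (T x))"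
      by (intro rbnd V cosb) (auto simp: indicator_def)
    have i2: "integrable N (\<lambda>x. (V x * (1 + sin (S x))) * indicator A (T x))"
      by (intro rbnd V cosb) (auto simp: indicator_def)
    have "(CLINT x|N. complex_of_real (V x * indicator A (T x)) * iexp (S x))
      = (CLINT x|N. complex_of_real ((V x * (1 + cos (S x))) * indicator A (T x) - V x * indicator A (T x))
         + \<i> * complex_of_real ((V x * (1 + sin (S x))) * indicator A (T x) - V x * indicator A (T x)))"
      by (intro Bochner_Integration.integral_cong refl)
        (simp add: exp_Euler cos_of_real sin_of_real algebra_simps indicator_def)
    also have "\<dots> = (CLINT x|N. complex_of_real ((V x * (1 + cos (S x))) * indicator A (T x) - V x * indicator A (T x)))
         + (CLINT x|N. \<i> * complex_of_real ((V x * (1 + sin (S x))) * indicator A (T x) - V x * indicator A (T x)))"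
      using i0 i1 i2
      by (intro Bochner_Integration.integral_add integrable_mult_right integrable_of_real Bochner_Integration.integrable_diff)
    finally show ?thesis
      using i0 i1 i2 by (simp only: integral_mult_right_zero integral_complex_of_real Bochner_Integration.integral_diff)
  qed
  show ?thesis
    unfolding dec[OF W(1) m(3,1)] dec[OF W'(1) m(4,2)] 0 1 2 ..
qed

text \<open>Indicators of coordinates are inserted one at a time next to the exponential. Once all
  are present, \<open>\<theta> = 0\<close> switches the exponential off and the measures of boxes
  agree.\<close>

lemma same_fdd_of_char_eq:
  fixes Z :: "'i \<Rightarrow> 'w \<Rightarrow> real" and Z' :: "'i \<Rightarrow> 'v \<Rightarrow> real"
  assumes M: "prob_space M" and M': "prob_space M'"
    and Z [measurable]: "\<And>t. Z t \<in> borel_measurable M" and Z' [measurable]: "\<And>t. Z' t \<in> borel_measurable M'"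
    and eq: "\<And>(n::nat) \<theta> s. (CLINT \<omega>|M. iexp (\<Sum>j<n. \<theta> j * Z (s j) \<omega>)) = (CLINT \<omega>|M'. iexp (\<Sum>j<n. \<theta> j * Z' (s j) \<omega>))"
  shows "same_fdd M Z M' Z'"
  unfolding same_fdd_def
proof (intro allI impI)
  fix I :: "'i set" assume I: "finite I"
  interpret M: prob_space M by fact
  interpret M': prob_space M' by fact
  have eqI: "(CLINT \<omega>|M. iexp (\<Sum>i\<in>I. \<theta> i * Z i \<omega>)) = (CLINT \<omega>|M'. iexp (\<Sum>i\<in>I. \<theta> i * Z' i \<omega>))" for \<theta>
  proof -
    obtain b where "bij_betw b {0..<card I} I" using ex_bij_betw_nat_finite[OF I] by blast
    then have b: "bij_betw b {..<card I} I" by (simp add: atLeast0LessThan)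
    have "(\<Sum>i\<in>I. \<theta> i * V i) = (\<Sum>j<card I. \<theta> (b j) * V (b j))" for V :: "'i \<Rightarrow> real"
      by (rule sum.reindex_bij_betw[OF b, symmetric])
    then show ?thesis using eq[where n="card I" and \<theta>="\<lambda>j. \<theta> (b j)" and s=b] by simp
  qed
  \<comment> \<open>The exponential over the whole of \<open>I\<close> stays in the statement with
    \<theta> arbitrary: inserting coordinate \<open>k\<close> needs the previous claim for all
    weights \<open>a * \<theta> i\<close>, shifted by \<open>u\<close> at \<open>k\<close>.\<close>
  have claim: "(CLINT \<omega>|M. complex_of_real (\<Prod>i\<in>J. indicat_real (A i) (Z i \<omega>)) * iexp (\<Sum>i\<in>I. \<theta> i * Z i \<omega>))
     = (CLINT \<omega>|M'. complex_of_real (\<Prod>i\<in>J. indicat_real (A i) (Z' i \<omega>)) * iexp (\<Sum>i\<in>I. \<theta> i * Z' i \<omega>))"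
    if A: "\<And>i. A i \<in> sets borel" and J: "J \<subseteq> I" for A J \<theta>
    using finite_subset[OF J I] J
  proof (induction J arbitrary: \<theta>)
    case empty
    show ?case using eqI[of \<theta>] by simp
  next
    case (insert k J \<theta>)
    note [measurable] = A
    have k: "k \<in> I" using insert by simp
    have shift: "a * (\<Sum>i\<in>I. \<theta> i * V i) + u * V k = (\<Sum>i\<in>I. (a * \<theta> i + (if i = k then u else 0)) * V i)"
      for a u and V :: "'i \<Rightarrow> real"
      using I k by (simp add: distrib_right sum.distrib sum_distrib_left mult.assoc if_distrib[where f="\<lambda>x. x * _"] sum.delta cong: if_cong)
    have p01: "0 \<le> (\<Prod>i\<in>J. indicat_real (A i) (v i))" "(\<Prod>i\<in>J. indicat_real (A i) (v i)) \<le> 1" for v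
      by (auto intro!: prod_nonneg prod_le_1)
    have "(CLINT \<omega>|M. complex_of_real ((\<Prod>i\<in>J. indicat_real (A i) (Z i \<omega>)) * indicator (A k) (Z k \<omega>)) * iexp (\<Sum>i\<in>I. \<theta> i * Z i \<omega>))
       = (CLINT \<omega>|M'. complex_of_real ((\<Prod>i\<in>J. indicat_real (A i) (Z' i \<omega>)) * indicator (A k) (Z' k \<omega>)) * iexp (\<Sum>i\<in>I. \<theta> i * Z' i \<omega>))"
    proof (rule indicator_integral_eq_of_char_eq_complex)
      show "integrable M (\<lambda>\<omega>. \<Prod>i\<in>J. indicat_real (A i) (Z i \<omega>))"
        by (rule M.integrable_const_bound[where B=1]) (use p01 in \<open>auto simp: abs_of_nonneg\<close>)
      show "integrable M' (\<lambda>\<omega>. \<Prod>i\<in>J. indicat_real (A i) (Z' i \<omega>))"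
        by (rule M'.integrable_const_bound[where B=1]) (use p01 in \<open>auto simp: abs_of_nonneg\<close>)
      show "(CLINT \<omega>|M. complex_of_real (\<Prod>i\<in>J. indicat_real (A i) (Z i \<omega>)) * iexp (a * (\<Sum>i\<in>I. \<theta> i * Z i \<omega>) + u * Z k \<omega>))
       = (CLINT \<omega>|M'. complex_of_real (\<Prod>i\<in>J. indicat_real (A i) (Z' i \<omega>)) * iexp (a * (\<Sum>i\<in>I. \<theta> i * Z' i \<omega>) + u * Z' k \<omega>))" for a u
        unfolding shift[of a "\<lambda>i. Z i _" u] shift[of a "\<lambda>i. Z' i _" u]
        by (rule insert.IH) (use insert.prems in simp)
    qed (use p01 A in auto)
    then show ?case
      using insert.hyps by (simp add: mult_ac)
  qed
  let ?D = "distr M (\<Pi>\<^sub>M i\<in>I. borel) (\<lambda>\<omega>. \<lambda>i\<in>I. Z i \<omega>)"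
  let ?D' = "distr M' (\<Pi>\<^sub>M i\<in>I. borel) (\<lambda>\<omega>. \<lambda>i\<in>I. Z' i \<omega>)"
  interpret D: prob_space ?D by (rule M.prob_space_distr) measurable
  have box: "emeasure (distr N (\<Pi>\<^sub>M i\<in>I. borel) (\<lambda>\<omega>. \<lambda>i\<in>I. V i \<omega>)) (Pi\<^sub>E I A)
      = ennreal (\<integral>\<omega>. (\<Prod>i\<in>I. indicat_real (A i) (V i \<omega>)) \<partial>N)"
    if "prob_space N" and [measurable]: "\<And>i. V i \<in> borel_measurable N" and A: "\<And>i. i \<in> I \<Longrightarrow> A i \<in> sets borel"
    for N :: "'z measure" and V and A :: "'i \<Rightarrow> real set"
  proof -
    interpret N: prob_space N by fact
    have [measurable]: "Pi\<^sub>E I A \<in> sets (\<Pi>\<^sub>M i\<in>I. borel)"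
      using I A by (intro sets_PiM_I_finite)
    define S where "S = {\<omega>\<in>space N. (\<lambda>i\<in>I. V i \<omega>) \<in> Pi\<^sub>E I A}"
    have [measurable]: "S \<in> sets N" unfolding S_def by measurable
    have "(\<integral>\<omega>. (\<Prod>i\<in>I. indicat_real (A i) (V i \<omega>)) \<partial>N) = (\<integral>\<omega>. indicator S \<omega> \<partial>N)"
    proof (intro Bochner_Integration.integral_cong refl)
      fix \<omega> assume "\<omega> \<in> space N"
      then show "(\<Prod>i\<in>I. indicat_real (A i) (V i \<omega>)) = indicator S \<omega>"
        using I by (auto simp: S_def indicator_def PiE_iff)
    qed
    also have "\<dots> = measure N S" by (simp add: S_def Int_absorb2)
    finally have "ennreal (\<integral>\<omega>. (\<Prod>i\<in>I. indicat_real (A i) (V i \<omega>)) \<partial>N) = emeasure N S"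
      by (simp add: N.emeasure_eq_measure)
    moreover have "emeasure (distr N (\<Pi>\<^sub>M i\<in>I. borel) (\<lambda>\<omega>. \<lambda>i\<in>I. V i \<omega>)) (Pi\<^sub>E I A) = emeasure N S"
      by (subst emeasure_distr) (auto simp: S_def vimage_def Int_def conj_commute)
    ultimately show ?thesis by simp
  qed
  show "?D = ?D'"
  proof (rule measure_eqI_PiM_finite[where A="\<lambda>_. space (\<Pi>\<^sub>M i\<in>I. borel :: real measure)"])
    fix A :: "'i \<Rightarrow> real set" assume A: "\<And>i. i \<in> I \<Longrightarrow> A i \<in> sets borel"
    \<comment> \<open>The claim asks for Borel sets at every index, while \<open>A\<close> is known
      to be Borel on \<open>I\<close> only.\<close>
    define B where "B i = (if i \<in> I then A i else {})" for i
    have B: "\<And>i. B i \<in> sets borel"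
      using A by (simp add: B_def)
    have AB: "Pi\<^sub>E I A = Pi\<^sub>E I B"
      by (rule PiE_cong) (simp add: B_def)
    have "complex_of_real (\<integral>\<omega>. (\<Prod>i\<in>I. indicat_real (B i) (Z i \<omega>)) \<partial>M)
        = complex_of_real (\<integral>\<omega>. (\<Prod>i\<in>I. indicat_real (B i) (Z' i \<omega>)) \<partial>M')"
      using claim[of B I "\<lambda>_. 0"] B unfolding integral_complex_of_real[symmetric] by simp
    then show "emeasure ?D (Pi\<^sub>E I A) = emeasure ?D' (Pi\<^sub>E I A)"
      unfolding AB using B by (simp add: box[OF M] box[OF M'])
  next
    show "range (\<lambda>_. space (\<Pi>\<^sub>M i\<in>I. borel :: real measure)) \<subseteq> prod_algebra I (\<lambda>_. borel)"
      by (auto simp: space_PiM intro!: prod_algebraI_finite I)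
  qed (use I in auto)
qed

section \<open>Exponents and time change\<close>

text \<open>The list \<open>t\<close> may repeat indices while \<open>same_fdd\<close> speaks of
  index sets; the law over the set of listed indices is pushed forward by the map that duplicates
  coordinates.\<close>

lemma same_fdd_list:
  fixes Z :: "'i \<Rightarrow> 'w \<Rightarrow> 'b::topological_space" and t :: "nat \<Rightarrow> 'i"
  assumes same: "same_fdd M Z M' Z'"
    and [measurable]: "\<And>t. Z t \<in> borel_measurable M" "\<And>t. Z' t \<in> borel_measurable M'"
  shows "distr M (\<Pi>\<^sub>M j\<in>{..<n}. borel) (\<lambda>\<omega>. \<lambda>j\<in>{..<n}. Z (t j) \<omega>)
       = distr M' (\<Pi>\<^sub>M j\<in>{..<n}. borel) (\<lambda>\<omega>. \<lambda>j\<in>{..<n}. Z' (t j) \<omega>)"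
proof -
  let ?I = "t ` {..<n}"
  let ?r = "\<lambda>x. \<lambda>j\<in>{..<n}. x (t j)"
  have r: "?r \<in> (\<Pi>\<^sub>M i\<in>?I. borel) \<rightarrow>\<^sub>M (\<Pi>\<^sub>M j\<in>{..<n}. borel)"
    by (intro measurable_restrict measurable_component_singleton) auto
  have "distr M (\<Pi>\<^sub>M j\<in>{..<n}. borel) (\<lambda>\<omega>. \<lambda>j\<in>{..<n}. Z (t j) \<omega>)
      = distr (distr M (\<Pi>\<^sub>M i\<in>?I. borel) (\<lambda>\<omega>. \<lambda>i\<in>?I. Z i \<omega>)) (\<Pi>\<^sub>M j\<in>{..<n}. borel) ?r"
    by (subst distr_distr[OF r]) (auto simp: comp_def intro!: distr_cong restrict_ext)
  also have "distr M (\<Pi>\<^sub>M i\<in>?I. borel) (\<lambda>\<omega>. \<lambda>i\<in>?I. Z i \<omega>)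
      = distr M' (\<Pi>\<^sub>M i\<in>?I. borel) (\<lambda>\<omega>. \<lambda>i\<in>?I. Z' i \<omega>)"
    using same unfolding same_fdd_def by simp
  also have "distr (distr M' (\<Pi>\<^sub>M i\<in>?I. borel) (\<lambda>\<omega>. \<lambda>i\<in>?I. Z' i \<omega>)) (\<Pi>\<^sub>M j\<in>{..<n}. borel) ?r
      = distr M' (\<Pi>\<^sub>M j\<in>{..<n}. borel) (\<lambda>\<omega>. \<lambda>j\<in>{..<n}. Z' (t j) \<omega>)"
    by (subst distr_distr[OF r]) (auto simp: comp_def intro!: distr_cong restrict_ext)
  finally show ?thesis .
qed

lemma same_fdd_integral:
  fixes Z :: "'i \<Rightarrow> 'w \<Rightarrow> 'b::topological_space" and t :: "nat \<Rightarrow> 'i"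
    and F :: "(nat \<Rightarrow> 'b) \<Rightarrow> 'c::{banach,second_countable_topology}"
  assumes "same_fdd M Z M' Z'"
    and [measurable]: "\<And>t. Z t \<in> borel_measurable M" "\<And>t. Z' t \<in> borel_measurable M'"
    and F: "F \<in> borel_measurable (\<Pi>\<^sub>M j\<in>{..<n}. borel)"
    and cut: "\<And>x. F (restrict x {..<n}) = F x"
  shows "(\<integral>\<omega>. F (\<lambda>j. Z (t j) \<omega>) \<partial>M) = (\<integral>\<omega>. F (\<lambda>j. Z' (t j) \<omega>) \<partial>M')"
proof -
  have push: "(\<integral>\<omega>. F (\<lambda>j. V (t j) \<omega>) \<partial>N)
     = integral\<^sup>L (distr N (\<Pi>\<^sub>M j\<in>{..<n}. borel) (\<lambda>\<omega>. \<lambda>j\<in>{..<n}. V (t j) \<omega>)) F"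
    if [measurable]: "\<And>t. V t \<in> borel_measurable N" for N :: "'z measure" and V
    by (subst integral_distr[OF _ F]) (auto simp: cut intro!: measurable_restrict)
  show ?thesis
    using push[of Z M, OF assms(2)] push[of Z' M', OF assms(3)] same_fdd_list[OF assms(1-3)]
    by simp
qed

lemma same_fdd_char:
  fixes Z :: "'i \<Rightarrow> 'w \<Rightarrow> real" and t :: "nat \<Rightarrow> 'i"
  assumes "same_fdd M Z M' Z'" "\<And>t. Z t \<in> borel_measurable M" "\<And>t. Z' t \<in> borel_measurable M'"
  shows "(CLINT \<omega>|M. iexp (\<Sum>j<n. \<theta> j * Z (t j) \<omega>)) = (CLINT \<omega>|M'. iexp (\<Sum>j<n. \<theta> j * Z' (t j) \<omega>))"
proof (rule same_fdd_integral[OF assms, where F="\<lambda>x. iexp (\<Sum>j<n. \<theta> j * x j)" and n=n])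
  have "(\<lambda>x. \<Sum>j<n. \<theta> j * x j) \<in> borel_measurable (\<Pi>\<^sub>M j\<in>{..<n}. borel)"
    by (intro borel_measurable_sum borel_measurable_times measurable_component_singleton) auto
  then show "(\<lambda>x. iexp (\<Sum>j<n. \<theta> j * x j)) \<in> borel_measurable (\<Pi>\<^sub>M j\<in>{..<n}. borel)"
    by measurable
qed simp

section \<open>The exponent and its invariances\<close>

definition stable_exponent ::
  "real \<Rightarrow> 'e measure \<Rightarrow> ('i \<Rightarrow> 'e \<Rightarrow> real) \<Rightarrow> nat \<Rightarrow> (nat \<Rightarrow> real) \<Rightarrow> (nat \<Rightarrow> 'i) \<Rightarrow> real" where
  "stable_exponent \<alpha> m f n \<theta> s = (LINT x|m. \<bar>\<Sum>j<n. \<theta> j * f (s j) x\<bar> powr \<alpha>)"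

lemma stable_exponent_nonneg: "0 \<le> stable_exponent \<alpha> m f n \<theta> s"
  unfolding stable_exponent_def by (intro Bochner_Integration.integral_nonneg) simp

lemma stable_exponent_scale:
  "stable_exponent \<alpha> m f n (\<lambda>j. c * \<theta> j) s = \<bar>c\<bar> powr \<alpha> * stable_exponent \<alpha> m f n \<theta> s"
proof -
  have "\<bar>\<Sum>j<n. c * \<theta> j * f (s j) x\<bar> powr \<alpha> = \<bar>c\<bar> powr \<alpha> * \<bar>\<Sum>j<n. \<theta> j * f (s j) x\<bar> powr \<alpha>" for x
    by (simp add: mult.assoc sum_distrib_left[symmetric] abs_mult powr_mult)
  then show ?thesis unfolding stable_exponent_def by simp
qed

lemma stable_representation_char:
  assumes "stable_representation \<alpha> m f M X"
  shows "(CLINT \<omega>|M. iexp (\<Sum>j<n. \<theta> j * X (s j) \<omega>)) = complex_of_real (exp (- stable_exponent \<alpha> m f n \<theta> s))"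
  using assms unfolding stable_representation_def stable_exponent_def by blast

text \<open>The exponents are real and \<open>exp\<close> is injective on the reals.\<close>

lemma stable_exponent_eqI:
  assumes "stable_representation \<alpha> m f M X"
    and "(CLINT \<omega>|M. iexp (\<Sum>j<n. \<theta> j * X (s j) \<omega>)) = (CLINT \<omega>|M. iexp (\<Sum>j<n'. \<theta>' j * X (s' j) \<omega>))"
  shows "stable_exponent \<alpha> m f n \<theta> s = stable_exponent \<alpha> m f n' \<theta>' s'"
  using assms(2) unfolding stable_representation_char[OF assms(1)] by simp

text \<open>The factor \<open>c powr H\<close> passes from \<open>X\<close> to the coefficients, in
  which the exponent is homogeneous of degree \<alpha>.\<close>

lemma self_similar_exponent:
  fixes X :: "real ^ 'd \<Rightarrow> 'w \<Rightarrow> real"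
  assumes rep: "stable_representation \<alpha> m f M X" and X: "\<And>t. X t \<in> borel_measurable M"
    and ss: "self_similar H M X" and c: "0 < c"
  shows "stable_exponent \<alpha> m f n \<theta> (\<lambda>j. c *\<^sub>R s j) = c powr (H * \<alpha>) * stable_exponent \<alpha> m f n \<theta> s"
proof -
  have fdd: "same_fdd M (\<lambda>t. X (c *\<^sub>R t)) M (\<lambda>t \<omega>. (c powr H) *\<^sub>R X t \<omega>)"
    using ss c unfolding self_similar_def by blast
  have m: "(\<lambda>\<omega>. (c powr H) *\<^sub>R X t \<omega>) \<in> borel_measurable M" for t
    using X[of t] by measurable
  have "stable_exponent \<alpha> m f n \<theta> (\<lambda>j. c *\<^sub>R s j) = stable_exponent \<alpha> m f n (\<lambda>j. c powr H * \<theta> j) s"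
    using same_fdd_char[OF fdd X m, where n=n and \<theta>=\<theta> and t=s]
    by (intro stable_exponent_eqI[OF rep]) (simp add: mult_ac)
  then show ?thesis
    using c by (simp add: stable_exponent_scale powr_powr)
qed

lemma translation_rigid_motion: "(\<lambda>t. t + b) \<in> rigid_motions"
  unfolding rigid_motions_def
  by (auto intro!: exI[of _ "mat 1"] exI[of _ b] simp: rotation_matrix_def orthogonal_matrix_id)

text \<open>Coefficients with sum 0 do not see a common subtracted value, so combinations of
  increments are combinations of the field itself.\<close>

lemma sis_exponent_translate:
  fixes X :: "real ^ 'd \<Rightarrow> 'w \<Rightarrow> real"
  assumes rep: "stable_representation \<alpha> m f M X" and X [measurable]: "\<And>t. X t \<in> borel_measurable M"
    and sis: "sis M X" and \<theta>: "(\<Sum>j<n. \<theta> j) = 0"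
  shows "stable_exponent \<alpha> m f n \<theta> (\<lambda>j. s j + b) = stable_exponent \<alpha> m f n \<theta> s"
proof -
  have fdd: "same_fdd M (\<lambda>t \<omega>. X (t + b) \<omega> - X (0 + b) \<omega>) M (\<lambda>t \<omega>. X t \<omega> - X 0 \<omega>)"
    using sis translation_rigid_motion[of b] unfolding sis_def by fast
  have e: "(\<Sum>j<n. \<theta> j * (V j - v)) = (\<Sum>j<n. \<theta> j * V j)" for V and v :: real
    using \<theta> by (simp add: right_diff_distrib sum_subtractf sum_distrib_right[symmetric])
  show ?thesis
    using same_fdd_char[OF fdd, where n=n and \<theta>=\<theta> and t=s]
    by (intro stable_exponent_eqI[OF rep]) (simp add: e)
qed

text \<open>Homogeneity controls \<open>p\<close> along each coordinate axis, and stationary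
  increments give a triangle inequality up to the factor \<open>2 powr \<alpha>\<close>. Decomposing
  \<open>s\<close> along the basis yields a constant built from the values of \<open>p\<close> at
  the basis vectors.\<close>

lemma sssis_exponent_bound:
  fixes X :: "real ^ 'd \<Rightarrow> 'w \<Rightarrow> real"
  assumes \<alpha>: "0 < \<alpha>" and H: "0 < H"
    and rep: "stable_representation \<alpha> m f M X" and X: "\<And>t. X t \<in> borel_measurable M"
    and ss: "sssis H M X"
  shows "\<exists>C\<ge>0. \<forall>s. (LINT x|m. \<bar>f s x\<bar> powr \<alpha>) \<le> C * norm s powr (H * \<alpha>)"
proof -
  define p where "p s = (LINT x|m. \<bar>f s x\<bar> powr \<alpha>)" for s
  have fL: "in_Lalpha \<alpha> m (f s)" for s
    using rep by (simp add: stable_representation_def)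
  have fm [measurable]: "f s \<in> borel_measurable m" for s
    using fL by (simp add: in_Lalpha_def)
  have fi: "integrable m (\<lambda>x. \<bar>f s x\<bar> powr \<alpha>)" for s
    using fL by (simp add: in_Lalpha_def)
  have self: "self_similar H M X" and sis: "sis M X"
    using ss by (auto simp: sssis_def)
  have p0: "0 \<le> p s" for s unfolding p_def by (intro Bochner_Integration.integral_nonneg) simp
  have p1: "p s = stable_exponent \<alpha> m f 1 (\<lambda>_. 1) (\<lambda>_. s)" for s
    unfolding p_def stable_exponent_def by simp
  have scale: "p (c *\<^sub>R s) = c powr (H * \<alpha>) * p s" if "0 < c" for c s
    unfolding p1 by (rule self_similar_exponent[OF rep X self that])
  \<comment> \<open>Scaling by 2 fixes the origin, and \<open>2 powr (H * \<alpha>)\<close> exceeds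
    1.\<close>
  have pz: "p 0 = 0"
  proof -
    have "p 0 = 2 powr (H * \<alpha>) * p 0" using scale[of 2 0] by simp
    moreover have "2 powr (H * \<alpha>) > (1::real)" using \<alpha> H by simp
    ultimately show ?thesis by (metis mult_cancel_right1 less_irrefl)
  qed
  have f0: "AE x in m. f 0 x = 0"
  proof -
    have "AE x in m. \<bar>f 0 x\<bar> powr \<alpha> = 0"
      using integral_nonneg_eq_0_iff_AE[OF fi] pz by (auto simp: p_def)
    then show ?thesis by eventually_elim simp
  qed
  \<comment> \<open>Increments have coefficients 1 and -1, so \<open>q\<close> is translation
    invariant; against the origin it reduces to \<open>p\<close>, since \<open>f 0\<close> vanishes
    almost everywhere.\<close>
  define q where "q s t = (LINT x|m. \<bar>f s x - f t x\<bar> powr \<alpha>)" for s t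
  have q2: "q s t = stable_exponent \<alpha> m f 2 (\<lambda>j. if j = 0 then 1 else - 1) (\<lambda>j. if j = 0 then s else t)" for s t
    unfolding q_def stable_exponent_def by (simp add: numeral_2_eq_2)
  have qt: "q (s + b) (t + b) = q s t" for s t b
  proof -
    have "(\<lambda>j::nat. if j = 0 then s + b else t + b) = (\<lambda>j. (if j = 0 then s else t) + b)" by auto
    then show ?thesis
      unfolding q2 by (simp only:) (rule sis_exponent_translate[OF rep X sis], simp add: numeral_2_eq_2)
  qed
  have qp: "q s 0 = p s" "q 0 s = p s" for s
  proof -
    have "AE x in m. \<bar>f s x - f 0 x\<bar> powr \<alpha> = \<bar>f s x\<bar> powr \<alpha>" "AE x in m. \<bar>f 0 x - f s x\<bar> powr \<alpha> = \<bar>f s x\<bar> powr \<alpha>"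
      using f0 by (auto elim!: eventually_mono)
    then show "q s 0 = p s" "q 0 s = p s"
      unfolding q_def p_def by (auto intro!: integral_cong_AE)
  qed
  have pminus: "p (- s) = p s" for s
    using qt[of "- s" s 0] by (simp add: qp)
  \<comment> \<open>Write \<open>f (s + t)\<close> as its increment from \<open>f t\<close> plus
    \<open>f t\<close>; by translation the increment has size \<open>p s\<close>.\<close>
  have padd: "p (s + t) \<le> 2 powr \<alpha> * (p s + p t)" for s t
  proof -
    have i: "integrable m (\<lambda>x. \<bar>f (s + t) x - f t x\<bar> powr \<alpha>)"
      using in_Lalpha_add[OF \<alpha> fL[of "s + t"] in_Lalpha_mult[OF fL[of t], of "- 1"]]
      by (simp add: in_Lalpha_def)
    have "p (s + t) \<le> (LINT x|m. 2 powr \<alpha> * (\<bar>f (s + t) x - f t x\<bar> powr \<alpha> + \<bar>f t x\<bar> powr \<alpha>))"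
      unfolding p_def
    proof (rule integral_mono)
      show "\<bar>f (s + t) x\<bar> powr \<alpha> \<le> 2 powr \<alpha> * (\<bar>f (s + t) x - f t x\<bar> powr \<alpha> + \<bar>f t x\<bar> powr \<alpha>)" for x
        using abs_add_powr_le[OF \<alpha>, of "f (s + t) x - f t x" "f t x"] by simp
    qed (use i fi in auto)
    also have "\<dots> = 2 powr \<alpha> * (q (s + t) t + p t)"
      unfolding q_def p_def using i fi by simp
    also have "q (s + t) t = p s"
      using qt[of s t 0] by (simp add: qp)
    finally show ?thesis .
  qed
  \<comment> \<open>\<open>scale\<close> takes positive factors, so the sign is removed by symmetry
    and a vanishing coefficient is treated apart.\<close>
  have coord: "p ((s \<bullet> b) *\<^sub>R b) \<le> p b * norm s powr (H * \<alpha>)" if b: "b \<in> Basis" for s b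
  proof -
    have "p ((s \<bullet> b) *\<^sub>R b) = p (\<bar>s \<bullet> b\<bar> *\<^sub>R b)"
      using pminus[of "(s \<bullet> b) *\<^sub>R b"] by (cases "0 \<le> s \<bullet> b") auto
    also have "\<dots> \<le> norm s powr (H * \<alpha>) * p b"
    proof (cases "s \<bullet> b = 0")
      case True
      then show ?thesis using p0 by (simp add: pz)
    next
      case False
      have "\<bar>s \<bullet> b\<bar> powr (H * \<alpha>) \<le> norm s powr (H * \<alpha>)"
        using Basis_le_norm[OF b] \<alpha> H by (intro powr_mono2) auto
      then show ?thesis using False p0 by (simp add: scale mult_right_mono)
    qed
    finally show ?thesis by (simp add: mult.commute)
  qed
  have "\<exists>C\<ge>0. \<forall>s. p (\<Sum>b\<in>J. (s \<bullet> b) *\<^sub>R b) \<le> C * norm s powr (H * \<alpha>)"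
    if "finite J" "J \<subseteq> Basis" for J :: "(real ^ 'd) set"
    using that
  proof induction
    case empty
    show ?case by (auto simp: pz intro!: exI[of _ 0])
  next
    case (insert b J)
    then obtain C where C: "0 \<le> C" "\<And>s. p (\<Sum>b\<in>J. (s \<bullet> b) *\<^sub>R b) \<le> C * norm s powr (H * \<alpha>)"
      by auto
    have "p (\<Sum>b\<in>insert b J. (s \<bullet> b) *\<^sub>R b) \<le> 2 powr \<alpha> * (p b + C) * norm s powr (H * \<alpha>)" for s
    proof -
      have "p (\<Sum>b\<in>insert b J. (s \<bullet> b) *\<^sub>R b)
          \<le> 2 powr \<alpha> * (p ((s \<bullet> b) *\<^sub>R b) + p (\<Sum>b\<in>J. (s \<bullet> b) *\<^sub>R b))"
        using insert.hyps padd by simp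
      also have "\<dots> \<le> 2 powr \<alpha> * (p b * norm s powr (H * \<alpha>) + C * norm s powr (H * \<alpha>))"
        using insert.prems by (intro mult_left_mono add_mono coord C) auto
      finally show ?thesis by (simp add: algebra_simps)
    qed
    then show ?case
      using C(1) p0 by (intro exI[of _ "2 powr \<alpha> * (p b + C)"]) auto
  qed
  from this[of Basis] show ?thesis
    by (simp add: euclidean_representation p_def)
qed

section \<open>Averaging the exponent over a random time\<close>

lemma measurable_stable_exponent:
  fixes f :: "'i::topological_space \<Rightarrow> 'e \<Rightarrow> real" and s :: "nat \<Rightarrow> 'z \<Rightarrow> 'i"
  assumes "sigma_finite_measure m" and f: "jointly_measurable_kernel m f"
    and s: "\<And>j. j < n \<Longrightarrow> s j \<in> borel_measurable N"
  shows "(\<lambda>x. stable_exponent \<alpha> m f n \<theta> (\<lambda>j. s j x)) \<in> borel_measurable N"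
proof -
  interpret sigma_finite_measure m by fact
  have "(\<lambda>z. f (s j (fst z)) (snd z)) \<in> borel_measurable (N \<Otimes>\<^sub>M m)" if j: "j < n" for j
  proof -
    have "(\<lambda>z. (s j (fst z), snd z)) \<in> N \<Otimes>\<^sub>M m \<rightarrow>\<^sub>M borel \<Otimes>\<^sub>M m"
      using s[OF j] by measurable
    from measurable_compose[OF this f[unfolded jointly_measurable_kernel_def]] show ?thesis by simp
  qed
  then have "(\<lambda>z. \<Sum>j<n. \<theta> j * f (s j (fst z)) (snd z)) \<in> borel_measurable (N \<Otimes>\<^sub>M m)"
    by (intro borel_measurable_sum borel_measurable_times) auto
  then have "(\<lambda>z. \<bar>\<Sum>j<n. \<theta> j * f (s j (fst z)) (snd z)\<bar> powr \<alpha>) \<in> borel_measurable (N \<Otimes>\<^sub>M m)"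
    by measurable
  then show ?thesis
    unfolding stable_exponent_def
    by (intro borel_measurable_lebesgue_integral) (simp add: case_prod_unfold)
qed

text \<open>The exponent is a measurable function of the \<open>n\<close> index values, by Fubini
  for the jointly measurable kernel, so its mean depends on the finite-dimensional laws
  alone.\<close>

lemma same_fdd_stable_exponent:
  fixes f :: "'i::topological_space \<Rightarrow> 'e \<Rightarrow> real"
  assumes "sigma_finite_measure m" and f: "jointly_measurable_kernel m f"
    and "same_fdd M Z M' Z'" "\<And>t. Z t \<in> borel_measurable M" "\<And>t. Z' t \<in> borel_measurable M'"
  shows "(\<integral>\<omega>. stable_exponent \<alpha> m f n \<theta> (\<lambda>j. Z (t j) \<omega>) \<partial>M)
      = (\<integral>\<omega>. stable_exponent \<alpha> m f n \<theta> (\<lambda>j. Z' (t j) \<omega>) \<partial>M')"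
proof (rule same_fdd_integral[OF assms(3-5), where F="stable_exponent \<alpha> m f n \<theta>" and n=n])
  show "stable_exponent \<alpha> m f n \<theta> \<in> borel_measurable (\<Pi>\<^sub>M j\<in>{..<n}. borel)"
    by (rule measurable_stable_exponent[OF assms(1) f, where s="\<lambda>j x. x j"])
      (rule measurable_component_singleton, simp)
  have "(\<Sum>j<n. \<theta> j * f (restrict x {..<n} j) y) = (\<Sum>j<n. \<theta> j * f (x j) y)" for x y
    by (intro sum.cong) auto
  then show "stable_exponent \<alpha> m f n \<theta> (restrict x {..<n}) = stable_exponent \<alpha> m f n \<theta> x" for x
    unfolding stable_exponent_def by simp
qed

text \<open>A combination with exponent \<open>E\<close> has exponent
  \<open>\<bar>u\<bar> powr \<alpha> * E\<close> at frequency \<open>u\<close>, so its scale is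
  \<open>E powr (1 / \<alpha>)\<close>, possibly 0.\<close>

lemma sas_process_of_representation:
  assumes \<alpha>: "0 < \<alpha>" and rep: "stable_representation \<alpha> m f M X"
    and X [measurable]: "\<And>t. X t \<in> borel_measurable M"
  shows "sas_process \<alpha> M X"
  unfolding sas_process_def sas_variable_def
proof (intro allI conjI)
  fix n :: nat and \<theta> s
  show m: "(\<lambda>\<omega>. \<Sum>j<n. \<theta> j * X (s j) \<omega>) \<in> borel_measurable M" by measurable
  define E where "E = stable_exponent \<alpha> m f n \<theta> s"
  have E: "0 \<le> E" unfolding E_def by (rule stable_exponent_nonneg)
  have "char (distr M borel (\<lambda>\<omega>. \<Sum>j<n. \<theta> j * X (s j) \<omega>)) u
      = complex_of_real (exp (- ((E powr (1 / \<alpha>)) powr \<alpha> * \<bar>u\<bar> powr \<alpha>)))" for u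
  proof -
    have "char (distr M borel (\<lambda>\<omega>. \<Sum>j<n. \<theta> j * X (s j) \<omega>)) u
        = (CLINT \<omega>|M. iexp (u * (\<Sum>j<n. \<theta> j * X (s j) \<omega>)))"
      unfolding char_def by (rule integral_distr[OF m]) measurable
    also have "\<dots> = (CLINT \<omega>|M. iexp (\<Sum>j<n. (u * \<theta> j) * X (s j) \<omega>))"
      by (simp only: sum_distrib_left mult.assoc)
    also have "\<dots> = complex_of_real (exp (- stable_exponent \<alpha> m f n (\<lambda>j. u * \<theta> j) s))"
      by (rule stable_representation_char[OF rep])
    finally show ?thesis
      using E \<alpha> unfolding stable_exponent_scale E_def[symmetric] by (simp add: powr_powr mult.commute)
  qed
  then show "\<exists>\<sigma>\<ge>0. \<forall>u. char (distr M borel (\<lambda>\<omega>. \<Sum>j<n. \<theta> j * X (s j) \<omega>)) u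
      = complex_of_real (exp (- (\<sigma> powr \<alpha> * \<bar>u\<bar> powr \<alpha>)))"
    by (intro exI[of _ "E powr (1 / \<alpha>)"]) simp
qed

theorem theorem2p4:
  fixes \<alpha> H H' :: real
    and P :: "'w measure" and P' :: "'v measure" and m :: "'e measure"
    and X :: "real ^ 'd \<Rightarrow> 'w \<Rightarrow> real"
    and f :: "real ^ 'd \<Rightarrow> 'e \<Rightarrow> real"
    and \<tau> :: "real ^ 'n \<Rightarrow> 'v \<Rightarrow> real ^ 'd"
  assumes "0 < \<alpha>" and "\<alpha> < 2" and "0 < H" and "0 < H'"
    and "FSF \<alpha> H P X"
    and "stable_representation \<alpha> m f P X"
    and "jointly_measurable_kernel m f"
    and "NdH_field H' P' \<tau>"
    and "measurable_field P' \<tau>"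
    and "\<And>t. integrable P' (\<lambda>\<omega>'. norm (\<tau> t \<omega>') powr (H * \<alpha>))"
  shows "represents_FSF \<alpha> (H' * H) (P' \<Otimes>\<^sub>M m) (random_time_kernel f \<tau>)"
proof -
  note \<alpha> = assms(1,2) and H = assms(3) and rep = assms(6) and fm = assms(7)
  have X: "X t \<in> borel_measurable P" for t
    using assms(5) by (simp add: FSF_def random_field_def)
  have Xss: "sssis H P X" and Xself: "self_similar H P X" and Xsis: "sis P X"
    using assms(5) by (auto simp: FSF_def sssis_def)
  have \<tau> [measurable]: "\<tau> t \<in> borel_measurable P'" for t
    using assms(8) by (simp add: NdH_field_def random_field_def)
  have \<tau>self: "self_similar H' P' \<tau>" and \<tau>sis: "sis P' \<tau>" and P': "prob_space P'"
    using assms(8) by (auto simp: NdH_field_def sssis_def random_field_def)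
  have fL: "in_Lalpha \<alpha> m (f s)" for s
    using rep by (auto simp: stable_representation_def)
  have sf: "sigma_finite_measure m"
    using rep by (auto simp: stable_representation_def)
  interpret P': prob_space P' by (rule P')
  interpret m: sigma_finite_measure m by (rule sf)
  interpret pp: pair_sigma_finite P' m ..
  let ?\<mu> = "P' \<Otimes>\<^sub>M m" and ?h = "random_time_kernel f \<tau>"
  have hm: "jointly_measurable_kernel ?\<mu> ?h"
  proof -
    note [measurable] = assms(9)[unfolded measurable_field_def]
    have "(\<lambda>z. (case (fst z, fst (snd z)) of (t, \<omega>) \<Rightarrow> \<tau> t \<omega>, snd (snd z))) \<in> borel \<Otimes>\<^sub>M ?\<mu> \<rightarrow>\<^sub>M borel \<Otimes>\<^sub>M m"
      by measurable
    from measurable_compose[OF this fm[unfolded jointly_measurable_kernel_def]] show ?thesis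
      unfolding jointly_measurable_kernel_def random_time_kernel_def by (simp add: case_prod_unfold)
  qed
  \<comment> \<open>The bound on the integral for \<open>f s\<close> is applied at
    \<open>s = \<tau> t \<omega>\<close> for each \<open>\<omega>\<close>, and the moment assumption
    integrates it.\<close>
  have hL: "in_Lalpha \<alpha> ?\<mu> (?h t)" for t
  proof -
    have [measurable]: "?h t \<in> borel_measurable ?\<mu>"
      using measurable_compose[OF measurable_Pair1' hm[unfolded jointly_measurable_kernel_def], of t] by simp
    obtain C where C: "0 \<le> C" "\<And>s. (LINT x|m. \<bar>f s x\<bar> powr \<alpha>) \<le> C * norm s powr (H * \<alpha>)"
      using sssis_exponent_bound[OF \<alpha>(1) H rep X Xss] by blast
    have "(\<integral>\<^sup>+z. ennreal (\<bar>?h t z\<bar> powr \<alpha>) \<partial>?\<mu>) = (\<integral>\<^sup>+\<omega>. (\<integral>\<^sup>+x. ennreal (\<bar>f (\<tau> t \<omega>) x\<bar> powr \<alpha>) \<partial>m) \<partial>P')"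
      by (subst m.nn_integral_fst[symmetric]) (measurable, simp add: random_time_kernel_def)
    also have "\<dots> \<le> (\<integral>\<^sup>+\<omega>. ennreal (C * norm (\<tau> t \<omega>) powr (H * \<alpha>)) \<partial>P')"
      using fL C by (intro nn_integral_mono, subst nn_integral_eq_integral)
        (auto simp: in_Lalpha_def intro!: ennreal_leI)
    also have "\<dots> = ennreal (\<integral>\<omega>. C * norm (\<tau> t \<omega>) powr (H * \<alpha>) \<partial>P')"
      using C assms(10) by (intro nn_integral_eq_integral) auto
    finally have "(\<integral>\<^sup>+z. ennreal (\<bar>?h t z\<bar> powr \<alpha>) \<partial>?\<mu>) < \<infinity>"
      by (rule le_less_trans) simp
    then show ?thesis
      unfolding in_Lalpha_def by (simp add: integrable_iff_bounded)
  qed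
  have sfP: "sigma_finite_measure ?\<mu>" by (rule pp.sigma_finite_measure_axioms)
  obtain Q :: "(nat \<Rightarrow> real \<times> ('v \<times> 'e)) measure" and Y
    where Q: "prob_space Q" and Yf: "measurable_field Q Y" and Yrep: "stable_representation \<alpha> ?\<mu> ?h Q Y"
    using stable_representation_exists[OF sfP \<alpha> hm hL] by blast
  have Y [measurable]: "Y t \<in> borel_measurable Q" for t
    using measurable_compose[OF measurable_Pair1' Yf[unfolded measurable_field_def], of t] by simp
  \<comment> \<open>Fubini turns the exponent of the random-time kernel into the mean of the
    exponent of \<open>f\<close> at the random times; both invariances below are read off from
    this.\<close>
  have mix: "stable_exponent \<alpha> ?\<mu> ?h n \<theta> t = (\<integral>\<omega>. stable_exponent \<alpha> m f n \<theta> (\<lambda>j. \<tau> (t j) \<omega>) \<partial>P')" for n \<theta> t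
  proof -
    have "integrable ?\<mu> (\<lambda>z. \<bar>\<Sum>j<n. \<theta> j * ?h (t j) z\<bar> powr \<alpha>)"
      using in_Lalpha_sum[OF \<alpha>(1), where h="\<lambda>j. ?h (t j)" and \<theta>=\<theta> and n=n, OF hL] by (simp add: in_Lalpha_def)
    from pp.integral_fst'[OF this] show ?thesis
      unfolding stable_exponent_def by (simp add: random_time_kernel_def)
  qed
  have "self_similar (H' * H) Q Y"
    unfolding self_similar_def
  proof (intro allI impI)
    fix c :: real assume c: "0 < c"
    have fdd: "same_fdd P' (\<lambda>t. \<tau> (c *\<^sub>R t)) P' (\<lambda>t \<omega>. (c powr H') *\<^sub>R \<tau> t \<omega>)"
      using \<tau>self c unfolding self_similar_def by blast
    show "same_fdd Q (\<lambda>t. Y (c *\<^sub>R t)) Q (\<lambda>t \<omega>. (c powr (H' * H)) *\<^sub>R Y t \<omega>)"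
    proof (rule same_fdd_of_char_eq[OF Q Q])
      fix n \<theta> s
      \<comment> \<open>First the law of \<open>\<tau>\<close> trades the factor \<open>c\<close>
        inside for \<open>c powr H'\<close> outside; then the exponent of \<open>f\<close> is
        homogeneous of degree \<open>H * \<alpha>\<close> for each fixed
        \<open>\<omega>\<close>.\<close>
      have "stable_exponent \<alpha> ?\<mu> ?h n \<theta> (\<lambda>j. c *\<^sub>R s j)
          = (\<integral>\<omega>. stable_exponent \<alpha> m f n \<theta> (\<lambda>j. c powr H' *\<^sub>R \<tau> (s j) \<omega>) \<partial>P')"
        unfolding mix by (rule same_fdd_stable_exponent[OF sf fm fdd]) measurable
      also have "\<dots> = (c powr H') powr (H * \<alpha>) * stable_exponent \<alpha> ?\<mu> ?h n \<theta> s"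
        using c by (simp add: self_similar_exponent[OF rep X Xself] mix)
      also have "\<dots> = stable_exponent \<alpha> ?\<mu> ?h n (\<lambda>j. c powr (H' * H) * \<theta> j) s"
        unfolding stable_exponent_scale by (simp add: powr_powr mult.assoc)
      finally have "(CLINT \<omega>|Q. iexp (\<Sum>j<n. \<theta> j * Y (c *\<^sub>R s j) \<omega>))
          = (CLINT \<omega>|Q. iexp (\<Sum>j<n. (c powr (H' * H) * \<theta> j) * Y (s j) \<omega>))"
        unfolding stable_representation_char[OF Yrep] by simp
      then show "(CLINT \<omega>|Q. iexp (\<Sum>j<n. \<theta> j * Y (c *\<^sub>R s j) \<omega>))
          = (CLINT \<omega>|Q. iexp (\<Sum>j<n. \<theta> j * (c powr (H' * H) *\<^sub>R Y (s j) \<omega>)))"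
        by (simp add: mult_ac)
    qed measurable
  qed
  moreover have "sis Q Y"
    unfolding sis_def
  proof
    fix g :: "real ^ 'n \<Rightarrow> real ^ 'n" assume g: "g \<in> rigid_motions"
    have fdd: "same_fdd P' (\<lambda>t \<omega>. \<tau> (g t) \<omega> - \<tau> (g 0) \<omega>) P' (\<lambda>t \<omega>. \<tau> t \<omega> - \<tau> 0 \<omega>)"
      using \<tau>sis g unfolding sis_def by blast
    show "same_fdd Q (\<lambda>t \<omega>. Y (g t) \<omega> - Y (g 0) \<omega>) Q (\<lambda>t \<omega>. Y t \<omega> - Y 0 \<omega>)"
    proof (rule same_fdd_of_char_eq[OF Q Q])
      fix n :: nat and \<theta> :: "nat \<Rightarrow> real" and s :: "nat \<Rightarrow> real ^ 'n"
      \<comment> \<open>The subtracted value at the origin becomes an additional term of index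
        \<open>n\<close>, whose coefficient makes the total 0, as translation invariance
        requires.\<close>
      define \<theta>' where "\<theta>' j = (if j < n then \<theta> j else - (\<Sum>j<n. \<theta> j))" for j
      define s' where "s' j = (if j < n then s j else 0)" for j
      have z: "(\<Sum>j<Suc n. \<theta>' j) = 0" by (simp add: \<theta>'_def)
      have inc: "(\<Sum>j<n. \<theta> j * (V (s j) - V 0)) = (\<Sum>j<Suc n. \<theta>' j * V (s' j))" for V :: "_ \<Rightarrow> real"
        by (simp add: \<theta>'_def s'_def right_diff_distrib sum_subtractf sum_distrib_right)
      \<comment> \<open>The shift \<open>b\<close> is arbitrary, so for each \<open>\<omega>\<close>
        separately it may be the random point \<open>\<tau> (g 0) \<omega>\<close> or
        \<open>\<tau> 0 \<omega>\<close>. This replaces values of \<open>\<tau>\<close> by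
        increments, whose law does not change under \<open>g\<close>.\<close>
      have tr: "stable_exponent \<alpha> m f (Suc n) \<theta>' (\<lambda>j. v j - b) = stable_exponent \<alpha> m f (Suc n) \<theta>' v" for v b
        using sis_exponent_translate[OF rep X Xsis z, of v "- b"] by simp
      have "stable_exponent \<alpha> ?\<mu> ?h (Suc n) \<theta>' (\<lambda>j. g (s' j))
          = (\<integral>\<omega>. stable_exponent \<alpha> m f (Suc n) \<theta>' (\<lambda>j. \<tau> (g (s' j)) \<omega> - \<tau> (g 0) \<omega>) \<partial>P')"
        unfolding mix tr ..
      also have "\<dots> = (\<integral>\<omega>. stable_exponent \<alpha> m f (Suc n) \<theta>' (\<lambda>j. \<tau> (s' j) \<omega> - \<tau> 0 \<omega>) \<partial>P')"
        by (rule same_fdd_stable_exponent[OF sf fm fdd]) measurable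
      also have "\<dots> = stable_exponent \<alpha> ?\<mu> ?h (Suc n) \<theta>' s'"
        unfolding mix tr ..
      finally have "(CLINT \<omega>|Q. iexp (\<Sum>j<Suc n. \<theta>' j * Y (g (s' j)) \<omega>))
          = (CLINT \<omega>|Q. iexp (\<Sum>j<Suc n. \<theta>' j * Y (s' j) \<omega>))"
        unfolding stable_representation_char[OF Yrep] by simp
      then show "(CLINT \<omega>|Q. iexp (\<Sum>j<n. \<theta> j * (Y (g (s j)) \<omega> - Y (g 0) \<omega>)))
          = (CLINT \<omega>|Q. iexp (\<Sum>j<n. \<theta> j * (Y (s j) \<omega> - Y 0 \<omega>)))"
        unfolding inc[of "\<lambda>t. Y (g t) _"] inc[of "\<lambda>t. Y t _"] .
    qed measurable
  qed
  ultimately have "FSF \<alpha> (H' * H) Q Y"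
    using Q Y Yf sas_process_of_representation[OF \<alpha>(1) Yrep Y]
    by (simp add: FSF_def random_field_def sssis_def)
  then show ?thesis
    unfolding represents_FSF_def using Yrep by blast
qed

end
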